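(* Let $x,y,z,w,u,v$ be variables, regarded as complex numbers with $xv\neq zu$, and let $\delta=\sqrt{xv-zu}$ and $\hat\delta=\sqrt{zu-xv}$. Then, as power series in $t$ (the right-hand side being expanded at $t=0$), $$\sum_{n=0}^\infty P_n(x,y,z,w,u,v)\frac{t^n}{n!}=\frac{z\left(pq(w-y)+(\hat\delta ps-\delta qr)\right)e^{\frac{w-y}{2}t+\frac{\delta^2}{4}t^2}}{(\hat\delta s-qy)\,D_{\frac{zu-yw}{\delta^2}}\left(\delta t+\frac{w-y}{\delta}\right)+(pw-\delta r)\,D_{\frac{xv-yw}{\hat\delta^2}}\left(\hat\delta t+\frac{y-w}{\hat\delta}\right)},$$ where $$p=D_{\frac{zu-yw}{\delta^2}}\left(\frac{w-y}{\delta}\right),\quad q=D_{\frac{xv-yw}{\hat\delta^2}}\left(\frac{y-w}{\hat\delta}\right),\quad r=D_{\frac{xv-yw}{\delta^2}}\left(\frac{w-y}{\delta}\right),\quad s=D_{\frac{zu-yw}{\hat\delta^2}}\left(\frac{y-w}{\hat\delta}\right).$$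
   Context: Permutation statistics. For a permutation $\pi=\pi_1\cdots\pi_n$ of $[n]=\{1,\dots,n\}$ put $\pi_0=0$. An index $1\le i\le n-1$ is an exterior peak if $\pi_{i-1}<\pi_i>\pi_{i+1}$; it is an exterior peak of pattern 132 if moreover $\pi_{i-1}<\pi_{i+1}$, and of pattern 231 if moreover $\pi_{i-1}>\pi_{i+1}$. An index $2\le i\le n-1$ is a proper double descent if $\pi_{i-1}>\pi_i>\pi_{i+1}$. Let $ep_1(\pi)$, $ep_2(\pi)$, $pdd(\pi)$ be the numbers of exterior peaks of pattern 132, exterior peaks of pattern 231, and proper double descents of $\pi$. For $n\ge 0$, with $\mathfrak S_n$ the set of permutations of $[n]$, $$P_n(x,y,z,w,u,v)=\sum_{\pi\in\mathfrak S_n}x^{ep_1(\pi)}v^{ep_1(\pi)}u^{ep_2(\pi)}z^{ep_2(\pi)+1}y^{pdd(\pi)}w^{n-2(ep_1(\pi)+ep_2(\pi))-pdd(\pi)}$$ (so $P_0=z$). Parabolic cylinder functions. With $(a)_0=1$, $(a)_n=a(a+1)\cdots(a+n-1)$ and ${}_1F_1(a;b;z)=\sum_{n\ge0}\frac{(a)_n}{(b)_n}\frac{z^n}{n!}$, define $$D_a(z)=2^{a/2}\sqrt{\pi}\,e^{-z^2/4}\left(\frac{1}{\Gamma\left(\frac{1-a}{2}\right)}\,{}_1F_1\left(-\frac a2;\frac12;\frac{z^2}{2}\right)-\frac{\sqrt2\,z}{\Gamma\left(-\frac a2\right)}\,{}_1F_1\left(\frac{1-a}{2};\frac32;\frac{z^2}{2}\right)\right),$$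 where $1/\Gamma$ is the entire function (equal to $0$ at the poles of $\Gamma$). The square roots satisfy $\hat\delta=i\delta$. *)

theory Defs
  imports "HOL-Complex_Analysis.Complex_Analysis" "HOL-Combinatorics.Permutations"
begin

(* A permutation of [n] is a function \<pi> with \<pi> permutes {1..n}. Such a function is the
   identity outside {1..n}, so \<pi> 0 = 0, which is the convention on \<pi>_0; the value
   at n + 1 is never used. *)

definition exterior_peak :: "nat \<Rightarrow> (nat \<Rightarrow> nat) \<Rightarrow> nat \<Rightarrow> bool" where
  "exterior_peak n \<pi> i \<longleftrightarrow> i \<in> {1..<n} \<and> \<pi> (i - 1) < \<pi> i \<and> \<pi> i > \<pi> (i + 1)"

(* pattern 132 *)
definition ep1 :: "nat \<Rightarrow> (nat \<Rightarrow> nat) \<Rightarrow> nat" where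
  "ep1 n \<pi> = card {i. exterior_peak n \<pi> i \<and> \<pi> (i - 1) < \<pi> (i + 1)}"

(* pattern 231 *)
definition ep2 :: "nat \<Rightarrow> (nat \<Rightarrow> nat) \<Rightarrow> nat" where
  "ep2 n \<pi> = card {i. exterior_peak n \<pi> i \<and> \<pi> (i - 1) > \<pi> (i + 1)}"

definition proper_double_descent :: "nat \<Rightarrow> (nat \<Rightarrow> nat) \<Rightarrow> nat \<Rightarrow> bool" where
  "proper_double_descent n \<pi> i \<longleftrightarrow> i \<in> {2..<n} \<and> \<pi> (i - 1) > \<pi> i \<and> \<pi> i > \<pi> (i + 1)"

definition pdd :: "nat \<Rightarrow> (nat \<Rightarrow> nat) \<Rightarrow> nat" where
  "pdd n \<pi> = card {i. proper_double_descent n \<pi> i}"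

(* The subtraction in the exponent of w never truncates: every maximal descending run
   \<pi>_i > ... > \<pi>_(i+d) with d > 0 starts at an exterior peak and contains d - 1 proper
   double descents, so it contributes d + 1 to 2 (ep1 + ep2) + pdd and occupies d + 1
   positions. *)
definition perm_poly ::
  "nat \<Rightarrow> complex \<Rightarrow> complex \<Rightarrow> complex \<Rightarrow> complex \<Rightarrow> complex \<Rightarrow> complex \<Rightarrow> complex" where
  "perm_poly n x y z w u v =
     (\<Sum>\<pi> | \<pi> permutes {1..n}.
        x ^ ep1 n \<pi> * v ^ ep1 n \<pi> * u ^ ep2 n \<pi> * z ^ (ep2 n \<pi> + 1) * y ^ pdd n \<pi> *
        w ^ (n - 2 * (ep1 n \<pi> + ep2 n \<pi>) - pdd n \<pi>))"

definition hyp1F1 :: "complex \<Rightarrow> complex \<Rightarrow> complex \<Rightarrow> complex" where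
  "hyp1F1 a b z = (\<Sum>n. pochhammer a n / pochhammer b n * (z ^ n / fact n))"

definition parabolic_cylinder :: "complex \<Rightarrow> complex \<Rightarrow> complex" where
  "parabolic_cylinder a z =
     2 powr (a / 2) * of_real (sqrt pi) * exp (- (z ^ 2) / 4) *
       (rGamma ((1 - a) / 2) * hyp1F1 (- a / 2) (1 / 2) (z ^ 2 / 2)
        - of_real (sqrt 2) * z * rGamma (- a / 2) * hyp1F1 ((1 - a) / 2) (3 / 2) (z ^ 2 / 2))"

end

theory Submission
  imports Defs
begin

text \<open>
  The weight of a permutation is a product over its letters (\<open>perm_weight_eq_statistics\<close>), and every permutation of
  \<open>{1..n + 1}\<close> arises exactly once by inserting the letter \<open>n + 1\<close> into a permutation of \<open>{1..n}\<close>
  (\<open>insert_max_bij\<close>). An insertion changes one factor only. Summed over all positions, the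
  changes are those of a derivation: with \<open>X = x v\<close> and \<open>Y = z u\<close>, if series in \<open>t\<close> satisfy
  \<open>X' = Y' = X y + Y w\<close>, \<open>w' = X\<close>, \<open>y' = Y\<close>, \<open>z' = z w\<close>, then the \<open>n\<close>-th derivative of \<open>z\<close> is
  \<open>z\<close> times the weight sum of the permutations of \<open>{1..n}\<close> (\<open>higher_deriv_eq_weight_sum\<close>). So the generating
  function is the component \<open>z(t)\<close> of the solution with the given initial values.

  The system can be solved. Both \<open>X - Y\<close> and \<open>X - w y\<close> are constant, and \<open>w - y\<close> has derivative \<open>X - Y\<close>;
  what remains is a Riccati equation for \<open>w\<close>. Substituting \<open>w = - K' / K\<close> linearises it to
  \<open>K'' + (c + \<delta>\<^sup>2 t) K' + (x v - y w) K = 0\<close> with \<open>c = w - y\<close> and \<open>\<delta>\<^sup>2 = x v - z u\<close>, where the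
  coefficients are the initial values; here \<open>K(0) = 1\<close> and \<open>K'(0) = - w\<close>, and \<open>z(t) = z / K(t)\<close> (\<open>perm_poly_egf_eq_reciprocal\<close>).

  Multiplication of \<open>K\<close> by the exponential in the numerator of the theorem turns this equation into Weber's equation, whose
  solutions are spanned by the two parabolic cylinder functions in the denominator. The ladder relations of
  these functions express the initial derivatives by \<open>p\<close>, \<open>q\<close>, \<open>r\<close>, \<open>s\<close>; this gives the coefficients in the
  denominator. The constant in the numerator is the Wronskian of the two solutions, and it is nonzero by
  \<open>parabolic_cylinder_wronskian\<close>.
\<close>

section \<open>Permutation statistics as a product of local weights\<close>

text \<open>
  The weight of a letter \<open>b\<close> between its neighbours \<open>a\<close> and \<open>c\<close>. A peak contributes \<open>X\<close> or \<open>Y\<close>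
  according to its pattern and a double descent contributes \<open>y\<close>. The letter that ends a descending
  run has weight \<open>1\<close>, because the peak at the top of the run already accounts for two positions;
  every other letter is entered by an ascent and is no peak, and contributes \<open>w\<close>.
\<close>
definition local_weight ::
  "'a::comm_semiring_1 \<Rightarrow> 'a \<Rightarrow> 'a \<Rightarrow> 'a \<Rightarrow> nat \<Rightarrow> nat \<Rightarrow> nat \<Rightarrow> 'a" where
  "local_weight X Y y w a b c =
     (if a < b then (if c < b then (if a < c then X else Y) else w)
      else (if c < b then y else 1))"

text \<open>
  The last factor reads \<open>\<pi> (n + 1)\<close>, which is \<open>n + 1\<close> for a permutation of \<open>{1..n}\<close>: the word behaves
  as if it were followed by a larger letter, so that position \<open>n\<close> is never a peak or a double descent.
\<close>
definition perm_weight ::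
  "'a::comm_semiring_1 \<Rightarrow> 'a \<Rightarrow> 'a \<Rightarrow> 'a \<Rightarrow> nat \<Rightarrow> (nat \<Rightarrow> nat) \<Rightarrow> 'a" where
  "perm_weight X Y y w n \<pi> =
     (\<Prod>i=1..n. local_weight X Y y w (\<pi> (i - 1)) (\<pi> i) (\<pi> (i + 1)))"

lemma permutes_interval_bounds:
  assumes "\<pi> permutes {1..n::nat}"
  shows "\<pi> 0 = 0" "\<pi> (n + 1) = n + 1" "j \<le> n \<Longrightarrow> \<pi> j \<le> n" "1 \<le> j \<Longrightarrow> 1 \<le> \<pi> j"
    "\<pi> j = \<pi> k \<longleftrightarrow> j = k"
proof -
  show "\<pi> 0 = 0" "\<pi> (n + 1) = n + 1"
    using assms by (auto intro!: permutes_not_in[OF assms])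
  show "j \<le> n \<Longrightarrow> \<pi> j \<le> n"
    using permutes_in_image[OF assms, of j] \<open>\<pi> 0 = 0\<close> by (cases "j = 0") auto
  show eq: "\<pi> j = \<pi> k \<longleftrightarrow> j = k" for j k
    using permutes_inj[OF assms] by (auto simp: inj_def)
  show "1 \<le> j \<Longrightarrow> 1 \<le> \<pi> j"
    using eq[of j 0] \<open>\<pi> 0 = 0\<close> by (cases "\<pi> j") auto
qed

lemma prod_if_one_eq_power_card:
  assumes "finite A"
  shows "(\<Prod>i\<in>A. if P i then c else 1) = (c::'a::comm_semiring_1) ^ card {i\<in>A. P i}"
  using assms by (subst prod.inter_filter[symmetric]) auto

lemma card_pred_shift:
  "card {i\<in>{1..n::nat}. P (i - 1)} = card {i\<in>{0..<n}. P i}"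
proof -
  have "bij_betw Suc {i\<in>{0..<n}. P i} {i\<in>{1..n}. P (i - 1)}"
    by (rule bij_betwI[where g = "\<lambda>i. i - 1"]) auto
  then show ?thesis by (rule bij_betw_same_card[symmetric])
qed

text \<open>
  The exponent of \<open>w\<close> counted directly. Among the \<open>n\<close> steps from position \<open>i - 1\<close> to position \<open>i\<close>, an
  ascent ends either at a peak or at a letter of weight \<open>w\<close>, and a descent starts either at a peak or
  at a proper double descent.
\<close>
lemma statistics_partition:
  assumes \<pi>: "\<pi> permutes {1..n}"
  shows "card {i\<in>{1..n}. \<pi> (i - 1) < \<pi> i \<and> \<not> \<pi> (i + 1) < \<pi> i} + 2 * (ep1 n \<pi> + ep2 n \<pi>) + pdd n \<pi> = n"
proof -
  note b = permutes_interval_bounds[OF \<pi>]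
  let ?A = "{i\<in>{1..n}. \<pi> (i - 1) < \<pi> i}" and ?D = "{i\<in>{1..n}. \<not> \<pi> (i - 1) < \<pi> i}"
  let ?W = "{i\<in>{1..n}. \<pi> (i - 1) < \<pi> i \<and> \<not> \<pi> (i + 1) < \<pi> i}"
  let ?E1 = "{i. exterior_peak n \<pi> i \<and> \<pi> (i - 1) < \<pi> (i + 1)}"
  let ?E2 = "{i. exterior_peak n \<pi> i \<and> \<pi> (i - 1) > \<pi> (i + 1)}"
  let ?P = "{i. proper_double_descent n \<pi> i}"
  have lt: "i < n" if "i \<in> {1..n}" "\<pi> (i + 1) < \<pi> i" for i
    using that b(2) b(3)[of i] by (cases "i = n") auto
  have ne: "\<pi> (i - 1) \<noteq> \<pi> (i + 1)" for i
    using b(5) by auto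
  have fin: "finite ?E1" "finite ?E2" "finite ?P"
    by (auto simp: exterior_peak_def proper_double_descent_def)
  have "?A = ?W \<union> (?E1 \<union> ?E2)"
  proof (intro equalityI subsetI)
    fix i assume "i \<in> ?A"
    then show "i \<in> ?W \<union> (?E1 \<union> ?E2)"
      using lt[of i] ne[of i] by (auto simp: exterior_peak_def)
  qed (auto simp: exterior_peak_def)
  moreover have "card (?W \<union> (?E1 \<union> ?E2)) = card ?W + (card ?E1 + card ?E2)"
  proof -
    have "card (?E1 \<union> ?E2) = card ?E1 + card ?E2"
      using fin by (intro card_Un_disjoint) auto
    moreover have "card (?W \<union> (?E1 \<union> ?E2)) = card ?W + card (?E1 \<union> ?E2)"
      using fin by (intro card_Un_disjoint) (auto simp: exterior_peak_def)
    ultimately show ?thesis by simp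
  qed
  ultimately have A: "card ?A = card ?W + ep1 n \<pi> + ep2 n \<pi>"
    by (simp add: ep1_def ep2_def)
  have "{i\<in>{0..<n}. \<not> \<pi> i < \<pi> (i + 1)} = ?P \<union> (?E1 \<union> ?E2)"
  proof (intro equalityI subsetI)
    fix i assume i: "i \<in> {i\<in>{0..<n}. \<not> \<pi> i < \<pi> (i + 1)}"
    have i0: "i \<noteq> 0" using i b(1) b(4)[of 1] by (cases "i = 0") auto
    have "\<pi> i > \<pi> (i + 1)" using i b(5)[of i "i + 1"] by auto
    moreover have "\<pi> (i - 1) \<noteq> \<pi> i" using b(5)[of "i - 1" i] i0 by auto
    moreover have "\<pi> (i - 1) > \<pi> i \<Longrightarrow> i \<ge> 2" using b(1) i0 by (cases "i = 1") auto
    ultimately show "i \<in> ?P \<union> (?E1 \<union> ?E2)"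
      using i i0 ne[of i] by (auto simp: exterior_peak_def proper_double_descent_def)
  qed (auto simp: exterior_peak_def proper_double_descent_def)
  moreover have "card (?P \<union> (?E1 \<union> ?E2)) = card ?P + (card ?E1 + card ?E2)"
  proof -
    have "card (?E1 \<union> ?E2) = card ?E1 + card ?E2"
      using fin by (intro card_Un_disjoint) auto
    moreover have "card (?P \<union> (?E1 \<union> ?E2)) = card ?P + card (?E1 \<union> ?E2)"
      using fin
      by (intro card_Un_disjoint) (auto simp: exterior_peak_def proper_double_descent_def)
    ultimately show ?thesis by simp
  qed
  moreover have "card ?D = card {i\<in>{0..<n}. \<not> \<pi> i < \<pi> (i + 1)}"
  proof -
    have "?D = {i\<in>{1..n}. \<not> \<pi> (i - 1) < \<pi> (i - 1 + 1)}" by auto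
    then show ?thesis using card_pred_shift[of n "\<lambda>i. \<not> \<pi> i < \<pi> (i + 1)"] by simp
  qed
  ultimately have D: "card ?D = pdd n \<pi> + ep1 n \<pi> + ep2 n \<pi>"
    by (simp add: ep1_def ep2_def pdd_def)
  have "card ?A + card ?D = card (?A \<union> ?D)"
    by (subst card_Un_disjoint) auto
  also have "?A \<union> ?D = {1..n}" by auto
  finally show ?thesis using A D by simp
qed

lemma perm_weight_eq_statistics:
  assumes \<pi>: "\<pi> permutes {1..n}"
  shows "perm_weight X Y y w n \<pi> =
     X ^ ep1 n \<pi> * Y ^ ep2 n \<pi> * y ^ pdd n \<pi> * w ^ (n - 2 * (ep1 n \<pi> + ep2 n \<pi>) - pdd n \<pi>)"
proof -
  note b = permutes_interval_bounds[OF \<pi>]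
  have lt: "i < n" if "i \<in> {1..n}" "\<pi> (i + 1) < \<pi> i" for i
    using that b(2) b(3)[of i] by (cases "i = n") auto
  have ne: "\<pi> (i - 1) \<noteq> \<pi> (i + 1)" for i
    using b(5) by auto
  have ge2: "2 \<le> i" if "i \<in> {1..n}" "\<not> \<pi> (i - 1) < \<pi> i" for i
    using that b(1) b(4)[of i] by (cases "i = 1") auto
  have ne1: "\<pi> (i - 1) \<noteq> \<pi> i" if "i \<in> {1..n}" for i
    using b(5)[of "i - 1" i] that by auto
  have "perm_weight X Y y w n \<pi> = (\<Prod>i=1..n.
      (if \<pi> (i - 1) < \<pi> i \<and> \<pi> (i + 1) < \<pi> i \<and> \<pi> (i - 1) < \<pi> (i + 1) then X else 1) *
      (if \<pi> (i - 1) < \<pi> i \<and> \<pi> (i + 1) < \<pi> i \<and> \<pi> (i - 1) > \<pi> (i + 1) then Y else 1) *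
      (if \<not> \<pi> (i - 1) < \<pi> i \<and> \<pi> (i + 1) < \<pi> i then y else 1) *
      (if \<pi> (i - 1) < \<pi> i \<and> \<not> \<pi> (i + 1) < \<pi> i then w else 1))"
    unfolding perm_weight_def local_weight_def
  proof (intro prod.cong refl, goal_cases)
    case (1 i)
    show ?case
      using ne[of i]
      by (cases "\<pi> (i - 1) < \<pi> i"; cases "\<pi> (i + 1) < \<pi> i"; cases "\<pi> (i - 1) < \<pi> (i + 1)")
        simp_all
  qed
  also have "\<dots> = X ^ card {i\<in>{1..n}. \<pi> (i - 1) < \<pi> i \<and> \<pi> (i + 1) < \<pi> i \<and> \<pi> (i - 1) < \<pi> (i + 1)} *
      Y ^ card {i\<in>{1..n}. \<pi> (i - 1) < \<pi> i \<and> \<pi> (i + 1) < \<pi> i \<and> \<pi> (i - 1) > \<pi> (i + 1)} *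
      y ^ card {i\<in>{1..n}. \<not> \<pi> (i - 1) < \<pi> i \<and> \<pi> (i + 1) < \<pi> i} *
      w ^ card {i\<in>{1..n}. \<pi> (i - 1) < \<pi> i \<and> \<not> \<pi> (i + 1) < \<pi> i}"
    by (simp only: prod.distrib prod_if_one_eq_power_card finite_atLeastAtMost)
  also have "{i\<in>{1..n}. \<pi> (i - 1) < \<pi> i \<and> \<pi> (i + 1) < \<pi> i \<and> \<pi> (i - 1) < \<pi> (i + 1)} =
      {i. exterior_peak n \<pi> i \<and> \<pi> (i - 1) < \<pi> (i + 1)}"
    using lt by (auto simp: exterior_peak_def)
  also have "{i\<in>{1..n}. \<pi> (i - 1) < \<pi> i \<and> \<pi> (i + 1) < \<pi> i \<and> \<pi> (i - 1) > \<pi> (i + 1)} =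
      {i. exterior_peak n \<pi> i \<and> \<pi> (i - 1) > \<pi> (i + 1)}"
    using lt by (auto simp: exterior_peak_def)
  also have "{i\<in>{1..n}. \<not> \<pi> (i - 1) < \<pi> i \<and> \<pi> (i + 1) < \<pi> i} = {i. proper_double_descent n \<pi> i}"
  proof (intro equalityI subsetI)
    fix i assume "i \<in> {i\<in>{1..n}. \<not> \<pi> (i - 1) < \<pi> i \<and> \<pi> (i + 1) < \<pi> i}"
    then show "i \<in> {i. proper_double_descent n \<pi> i}"
      using lt[of i] ge2[of i] ne1[of i] by (auto simp: proper_double_descent_def)
  qed (auto simp: proper_double_descent_def)
  also have "card {i\<in>{1..n}. \<pi> (i - 1) < \<pi> i \<and> \<not> \<pi> (i + 1) < \<pi> i} =
      n - 2 * (ep1 n \<pi> + ep2 n \<pi>) - pdd n \<pi>"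
    using statistics_partition[OF \<pi>] by simp
  finally show ?thesis
    by (simp add: ep1_def ep2_def pdd_def)
qed

section \<open>Inserting the largest letter\<close>

definition insert_max :: "nat \<Rightarrow> nat \<Rightarrow> (nat \<Rightarrow> nat) \<Rightarrow> nat \<Rightarrow> nat" where
  "insert_max n k \<pi> j =
     (if j < k then \<pi> j else if j = k then n + 1 else if j \<le> n + 1 then \<pi> (j - 1) else j)"

lemma insert_max_permutes:
  assumes \<pi>: "\<pi> permutes {1..n}" and k: "k \<in> {1..n + 1}"
  shows "insert_max n k \<pi> permutes {1..n + 1}"
proof (rule bij_imp_permutes)
  note b = permutes_interval_bounds[OF \<pi>]
  have le: "\<pi> j < n + 1" if "j \<le> n" for j using b(3)[OF that] by simp
  have "inj_on (insert_max n k \<pi>) {1..n + 1}"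
  proof (rule inj_onI)
    fix i j assume ij: "i \<in> {1..n + 1}" "j \<in> {1..n + 1}" "insert_max n k \<pi> i = insert_max n k \<pi> j"
    have "\<pi> (i - 1) \<noteq> n + 1" "\<pi> (j - 1) \<noteq> n + 1"
      using ij(1,2) b(3)[of "i - 1"] b(3)[of "j - 1"] by fastforce+
    moreover have "\<pi> i \<noteq> n + 1" if "i < k" using that k le[of i] by auto
    moreover have "\<pi> j \<noteq> n + 1" if "j < k" using that k le[of j] by auto
    ultimately show "i = j"
      using ij k b(5) by (auto simp: insert_max_def split: if_splits)
  qed
  moreover have "insert_max n k \<pi> ` {1..n + 1} \<subseteq> {1..n + 1}"
    using k b(3) b(4) by (fastforce simp: insert_max_def le_Suc_eq)
  ultimately show "bij_betw (insert_max n k \<pi>) {1..n + 1} {1..n + 1}"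
    by (simp add: bij_betw_def endo_inj_surj)
  show "insert_max n k \<pi> j = j" if "j \<notin> {1..n + 1}" for j
    using that k b(1) by (cases "j = 0") (auto simp: insert_max_def)
qed

lemma insert_max_inj:
  "inj_on (\<lambda>(\<pi>, k). insert_max n k \<pi>) ({\<pi>. \<pi> permutes {1..n}} \<times> {1..n + 1})"
proof -
  have "\<pi> = \<rho> \<and> k = l"
    if \<pi>: "\<pi> permutes {1..n}" and \<rho>: "\<rho> permutes {1..n}"
      and k: "k \<in> {1..n + 1}" and l: "l \<in> {1..n + 1}"
      and eq: "\<And>j. insert_max n k \<pi> j = insert_max n l \<rho> j" for \<pi> \<rho> k l
  proof -
    have kl: "k = l"
    proof (rule ccontr)
      assume "k \<noteq> l"
      moreover have "\<rho> k \<noteq> n + 1" if "k < l"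
        using permutes_interval_bounds(3)[OF \<rho>, of k] that l by auto
      moreover have "\<rho> (k - 1) \<noteq> n + 1"
        using permutes_interval_bounds(3)[OF \<rho>, of "k - 1"] k by (cases k) auto
      moreover have "insert_max n l \<rho> k = n + 1"
        using eq[of k] by (simp add: insert_max_def)
      ultimately show False
        using k by (auto simp: insert_max_def split: if_splits)
    qed
    have "\<pi> j = \<rho> j" for j
    proof -
      consider "j < k" | "k \<le> j" "j \<le> n" | "n < j" by linarith
      then show ?thesis
      proof cases
        case 1
        then show ?thesis using eq[of j] kl by (simp add: insert_max_def)
      next
        case 2
        then show ?thesis using eq[of "j + 1"] kl by (simp add: insert_max_def)
      next
        case 3
        then show ?thesis using permutes_not_in[OF \<pi>, of j] permutes_not_in[OF \<rho>, of j] by simp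
      qed
    qed
    then have "\<pi> = \<rho>" by (rule ext)
    with kl show ?thesis by simp
  qed
  note inj = this
  show ?thesis
  proof (rule inj_onI, unfold split_paired_all split_conv prod.inject mem_Sigma_iff mem_Collect_eq)
    fix \<pi> \<rho> k l
    assume "\<pi> permutes {1..n} \<and> k \<in> {1..n + 1}" "\<rho> permutes {1..n} \<and> l \<in> {1..n + 1}"
      "insert_max n k \<pi> = insert_max n l \<rho>"
    then show "\<pi> = \<rho> \<and> k = l" by (intro inj) (simp_all only:)
  qed
qed

text \<open>
  Surjectivity comes for free from injectivity, since both sides have \<open>(n + 1)!\<close> elements.
\<close>
lemma insert_max_bij:
  "bij_betw (\<lambda>(\<pi>, k). insert_max n k \<pi>)
     ({\<pi>. \<pi> permutes {1..n}} \<times> {1..n + 1}) {\<sigma>. \<sigma> permutes {1..n + 1}}"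
proof -
  let ?f = "\<lambda>(\<pi>, k). insert_max n k \<pi>" and ?A = "{\<pi>. \<pi> permutes {1..n}} \<times> {1..n + 1}"
  have "card (?f ` ?A) = card ?A"
    by (rule card_image[OF insert_max_inj])
  also have "\<dots> = card {\<sigma>. \<sigma> permutes {1..n + 1}}"
    using card_permutations[of "{1..n}" n] card_permutations[of "{1..n + 1}" "n + 1"]
    by (simp add: card_cartesian_product)
  finally have "?f ` ?A = {\<sigma>. \<sigma> permutes {1..n + 1}}"
    using insert_max_permutes by (intro card_subset_eq finite_permutations) auto
  then show ?thesis using insert_max_inj by (simp add: bij_betw_def)
qed

lemma prod_insert_position:
  fixes f g :: "nat \<Rightarrow> 'a::comm_monoid_mult"
  assumes i: "i \<in> {1..n}"
    and below: "\<And>j. j \<in> {1..<i} \<Longrightarrow> g j = f j"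
    and above: "\<And>j. j \<in> {i + 1..n} \<Longrightarrow> g (j + 1) = f j"
  shows "prod g {1..n + 1} = g i * g (i + 1) * prod f ({1..n} - {i})"
proof -
  have "{1..n + 1} = {1..<i} \<union> ({i, i + 1} \<union> {i + 1 + 1..n + 1})"
    using i by auto
  then have "prod g {1..n + 1} = prod g {1..<i} * (prod g {i, i + 1} * prod g {i + 1 + 1..n + 1})"
    by (simp only:) (subst prod.union_disjoint; auto simp: mult_ac)+
  also have "prod g {i + 1 + 1..n + 1} = prod f {i + 1..n}"
    using above by (subst prod.shift_bounds_cl_nat_ivl) (auto intro!: prod.cong)
  also have "prod g {1..<i} = prod f {1..<i}"
    using below by (auto intro!: prod.cong)
  also have "prod g {i, i + 1} = g i * g (i + 1)" by simp
  finally have "prod g {1..n + 1} = g i * g (i + 1) * (prod f {1..<i} * prod f {i + 1..n})"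
    by (simp add: mult_ac)
  also have "prod f {1..<i} * prod f {i + 1..n} = prod f ({1..<i} \<union> {i + 1..n})"
    by (subst prod.union_disjoint) auto
  also have "{1..<i} \<union> {i + 1..n} = {1..n} - {i}" using i by auto
  finally show ?thesis .
qed

text \<open>
  Only the order type of a letter and its neighbours matters; hence a neighbour that is larger than the
  letter may be replaced by the new maximum, which confines the effect of an insertion to one factor.
\<close>
lemma local_weight_right_larger:
  "b < c \<Longrightarrow> b < c' \<Longrightarrow> local_weight X Y y w a b c = local_weight X Y y w a b c'"
  by (simp add: local_weight_def)

lemma local_weight_left_larger:
  "b < a \<Longrightarrow> b < a' \<Longrightarrow> local_weight X Y y w a b c = local_weight X Y y w a' b c"
  by (simp add: local_weight_def)

lemma insert_max_values:
  "j < k \<Longrightarrow> insert_max n k \<pi> j = \<pi> j"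
  "insert_max n k \<pi> k = n + 1"
  "k \<le> j \<Longrightarrow> j \<le> n \<Longrightarrow> insert_max n k \<pi> (j + 1) = \<pi> j"
  "k \<le> n + 1 \<Longrightarrow> insert_max n k \<pi> (n + 2) = n + 2"
  by (auto simp: insert_max_def)

text \<open>
  To the right of the insertion the factors are merely shifted. At the end of the word the
  sentinel changes from \<open>n + 1\<close> to \<open>n + 2\<close>, which the weight does not see.
\<close>
lemma local_weight_insert_after:
  assumes \<pi>: "\<pi> permutes {1..n}" and k: "1 \<le> k" "k < j" and j: "j \<le> n"
  shows "local_weight X Y y w (insert_max n k \<pi> j) (insert_max n k \<pi> (j + 1)) (insert_max n k \<pi> (j + 2)) =
    local_weight X Y y w (\<pi> (j - 1)) (\<pi> j) (\<pi> (j + 1))"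
proof -
  obtain l where l: "j = l + 1" using k(2) by (cases j) auto
  have "insert_max n k \<pi> j = \<pi> (j - 1)" "insert_max n k \<pi> (j + 1) = \<pi> j"
    using insert_max_values(3)[of k l n \<pi>] insert_max_values(3)[of k j n \<pi>] k j l by simp_all
  moreover have "insert_max n k \<pi> (j + 2) = \<pi> (j + 1)" if "j < n"
    using insert_max_values(3)[of k "j + 1" n \<pi>] k that by simp
  moreover have "insert_max n k \<pi> (j + 2) = n + 2" if "j = n"
    using insert_max_values(4)[of k n \<pi>] k that by simp
  ultimately show ?thesis
    using permutes_interval_bounds(2)[OF \<pi>] permutes_interval_bounds(3)[OF \<pi> j] j
    by (cases "j = n") (auto intro: local_weight_right_larger)
qed

text \<open>
  Inserting the maximum into the ascent before position \<open>i\<close> replaces the factor at \<open>i\<close>: the maximum is a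
  peak of pattern 132 (weight \<open>X\<close>), and the letter after it becomes a double descent if it was a
  peak and the end of a descending run otherwise. The letter before it keeps its weight.
\<close>
lemma perm_weight_insert_ascent:
  assumes \<pi>: "\<pi> permutes {1..n}" and i: "i \<in> {1..n}" and asc: "\<pi> (i - 1) < \<pi> i"
  shows "perm_weight X Y y w (n + 1) (insert_max n i \<pi>) =
     X * (if \<pi> (i + 1) < \<pi> i then y else 1) *
     (\<Prod>j\<in>{1..n} - {i}. local_weight X Y y w (\<pi> (j - 1)) (\<pi> j) (\<pi> (j + 1)))"
proof -
  note b = permutes_interval_bounds[OF \<pi>]
  let ?\<sigma> = "insert_max n i \<pi>"
  let ?g = "\<lambda>j. local_weight X Y y w (?\<sigma> (j - 1)) (?\<sigma> j) (?\<sigma> (j + 1))"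
  let ?f = "\<lambda>j. local_weight X Y y w (\<pi> (j - 1)) (\<pi> j) (\<pi> (j + 1))"
  have \<sigma>: "?\<sigma> (i - 1) = \<pi> (i - 1)" "?\<sigma> i = n + 1" "?\<sigma> (i + 1) = \<pi> i"
    using i insert_max_values(3)[of i i n \<pi>] by (auto simp: insert_max_values)
  have \<pi>i: "\<pi> i \<le> n" "\<pi> (i - 1) \<le> n" using b(3)[of i] b(3)[of "i - 1"] i by auto
  have "prod ?g {1..n + 1} = ?g i * ?g (i + 1) * prod ?f ({1..n} - {i})"
  proof (rule prod_insert_position[OF i])
    fix j assume j: "j \<in> {1..<i}"
    show "?g j = ?f j"
    proof (cases "j + 1 = i")
      case True
      have "j - 1 < i" "j < i" "i - 1 = j" using j True by auto
      then show ?thesis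
        using True \<sigma>(2) \<pi>i asc
        by (auto simp: insert_max_values(1) intro: local_weight_right_larger)
    next
      case False
      then have "j - 1 < i" "j < i" "j + 1 < i" using j by auto
      then show ?thesis by (simp add: insert_max_values(1))
    qed
  next
    fix j assume "j \<in> {i + 1..n}"
    then show "?g (j + 1) = ?f j"
      using local_weight_insert_after[OF \<pi>, of i j X Y y w] i by simp
  qed
  also have "?g i = X"
    unfolding \<sigma> using asc \<pi>i by (simp add: local_weight_def)
  also have "?g (i + 1) = (if \<pi> (i + 1) < \<pi> i then y else 1)"
  proof (cases "i = n")
    case True
    then show ?thesis
      using \<sigma> b(2) \<pi>i insert_max_values(4)[of n n \<pi>] by (simp add: local_weight_def)
  next
    case False
    then have "?\<sigma> (i + 1 + 1) = \<pi> (i + 1)"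
      using i by (intro insert_max_values(3)) auto
    then show ?thesis
      using \<sigma> \<pi>i by (simp add: local_weight_def)
  qed
  finally show ?thesis by (simp add: perm_weight_def)
qed

text \<open>
  Inserting the maximum into the descent after position \<open>i\<close> again replaces only the factor at \<open>i\<close>: the
  maximum is a peak of pattern 231 (weight \<open>Y\<close>), and the letter before it loses its descent, so it has
  weight \<open>w\<close> if it was a peak and \<open>1\<close> if it was a double descent.
\<close>
lemma perm_weight_insert_descent:
  assumes \<pi>: "\<pi> permutes {1..n}" and i: "i \<in> {1..n}" and desc: "\<pi> (i + 1) < \<pi> i"
  shows "perm_weight X Y y w (n + 1) (insert_max n (i + 1) \<pi>) =
     Y * (if \<pi> (i - 1) < \<pi> i then w else 1) *
     (\<Prod>j\<in>{1..n} - {i}. local_weight X Y y w (\<pi> (j - 1)) (\<pi> j) (\<pi> (j + 1)))"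
proof -
  note b = permutes_interval_bounds[OF \<pi>]
  let ?\<sigma> = "insert_max n (i + 1) \<pi>"
  let ?g = "\<lambda>j. local_weight X Y y w (?\<sigma> (j - 1)) (?\<sigma> j) (?\<sigma> (j + 1))"
  let ?f = "\<lambda>j. local_weight X Y y w (\<pi> (j - 1)) (\<pi> j) (\<pi> (j + 1))"
  have \<pi>i: "\<pi> i \<le> n" using b(3)[of i] i by auto
  have lt: "i < n" using i desc b(2) \<pi>i by (cases "i = n") auto
  have \<sigma>: "?\<sigma> (i - 1) = \<pi> (i - 1)" "?\<sigma> i = \<pi> i" "?\<sigma> (i + 1) = n + 1" "?\<sigma> (i + 1 + 1) = \<pi> (i + 1)"
    using i lt insert_max_values(3)[of "i + 1" "i + 1" n \<pi>] by (auto simp: insert_max_values)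
  have "prod ?g {1..n + 1} = ?g i * ?g (i + 1) * prod ?f ({1..n} - {i})"
  proof (rule prod_insert_position[OF i])
    fix j assume "j \<in> {1..<i}"
    then have "j - 1 < i + 1" "j < i + 1" "j + 1 < i + 1" by auto
    then show "?g j = ?f j" by (simp only: insert_max_values(1))
  next
    fix j assume j: "j \<in> {i + 1..n}"
    show "?g (j + 1) = ?f j"
    proof (cases "j = i + 1")
      case True
      have "?g (j + 1) = local_weight X Y y w (n + 1) (\<pi> j) (?\<sigma> (j + 2))"
        using True \<sigma> by simp
      also have "\<dots> = local_weight X Y y w (\<pi> i) (\<pi> j) (?\<sigma> (j + 2))"
        using True desc \<pi>i by (intro local_weight_left_larger) auto
      also have "\<dots> = ?f j"
      proof (cases "j = n")
        case jn: True
        then have "?\<sigma> (j + 2) = n + 2" "\<pi> (j + 1) = n + 1" "j - 1 = i" "\<pi> j \<le> n"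
          using True b(2) b(3)[of j] insert_max_values(4)[of "i + 1" n \<pi>] lt by simp_all
        then show ?thesis
          by (simp only:) (rule local_weight_right_larger; simp)
      next
        case False
        then have "?\<sigma> (j + 1 + 1) = \<pi> (j + 1)"
          using j by (intro insert_max_values(3)) auto
        then show ?thesis using True by simp
      qed
      finally show ?thesis .
    next
      case False
      then show ?thesis
        using local_weight_insert_after[OF \<pi>, of "i + 1" j X Y y w] j by simp
    qed
  qed
  also have "?g i = (if \<pi> (i - 1) < \<pi> i then w else 1)"
    unfolding \<sigma> using \<pi>i by (simp add: local_weight_def)
  also have "?g (i + 1) = Y"
    using \<sigma> desc \<pi>i by (simp add: local_weight_def)
  finally show ?thesis by (simp add: perm_weight_def mult_ac)
qed

lemma perm_weight_insert_end:
  assumes \<pi>: "\<pi> permutes {1..n}"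
  shows "perm_weight X Y y w (n + 1) (insert_max n (n + 1) \<pi>) = w * perm_weight X Y y w n \<pi>"
proof -
  note b = permutes_interval_bounds[OF \<pi>]
  have \<sigma>: "insert_max n (n + 1) \<pi> = \<pi>"
    using permutes_not_in[OF \<pi>] by (auto simp: insert_max_def fun_eq_iff)
  have "\<pi> (n + 1 + 1) = n + 1 + 1" by (rule permutes_not_in[OF \<pi>]) auto
  then show ?thesis
    using b(2) b(3)[of n] unfolding \<sigma> perm_weight_def
    by (simp add: local_weight_def mult_ac)
qed

section \<open>Insertion as a derivation\<close>

lemma fps_deriv_prod:
  fixes f :: "'b \<Rightarrow> 'a::comm_ring_1 fps"
  assumes "finite A"
  shows "fps_deriv (prod f A) = (\<Sum>i\<in>A. fps_deriv (f i) * prod f (A - {i}))"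
  using assms
proof (induction A rule: finite_induct)
  case (insert a A)
  have "prod f (insert a A - {i}) = f a * prod f (A - {i})" if "i \<in> A" for i
  proof -
    have "insert a A - {i} = insert a (A - {i})" using that insert by auto
    then show ?thesis using insert by simp
  qed
  then show ?case
    using insert by (simp add: sum_distrib_left mult_ac)
qed simp

text \<open>
  Each insertion other than at the end is charged to one factor: an ascent to the letter that ends it, a
  descent to the letter that starts it. A peak then receives \<open>X * y\<close> from the ascent before it and \<open>Y * w\<close>
  from the descent after it, a double descent receives \<open>Y\<close>, a letter of weight \<open>w\<close> receives
  \<open>X\<close>, and a letter of weight \<open>1\<close> receives nothing. These are the derivatives of the factors, so the sum over
  all insertions is the product rule.
\<close>
lemma fps_deriv_perm_weight:
  fixes X Y y w :: "'a::comm_ring_1 fps"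
  assumes \<pi>: "\<pi> permutes {1..n}"
    and X: "fps_deriv X = X * y + Y * w" and Y: "fps_deriv Y = X * y + Y * w"
    and y: "fps_deriv y = Y" and w: "fps_deriv w = X"
  shows "fps_deriv (perm_weight X Y y w n \<pi>) =
     (\<Sum>k=1..n. perm_weight X Y y w (n + 1) (insert_max n k \<pi>))"
proof -
  note b = permutes_interval_bounds[OF \<pi>]
  let ?f = "\<lambda>j. local_weight X Y y w (\<pi> (j - 1)) (\<pi> j) (\<pi> (j + 1))"
  let ?W = "\<lambda>k. perm_weight X Y y w (n + 1) (insert_max n k \<pi>)"
  let ?asc = "\<lambda>i. \<pi> (i - 1) < \<pi> i" and ?desc = "\<lambda>i. \<pi> (i + 1) < \<pi> i"
  have "fps_deriv (?f i) * prod ?f ({1..n} - {i}) =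
      (if ?asc i then ?W i else 0) + (if ?desc i then ?W (i + 1) else 0)" if i: "i \<in> {1..n}" for i
  proof -
    have "(if ?asc i then ?W i else 0) + (if ?desc i then ?W (i + 1) else 0) =
       ((if ?asc i then X * (if ?desc i then y else 1) else 0) +
        (if ?desc i then Y * (if ?asc i then w else 1) else 0)) * prod ?f ({1..n} - {i})"
      using perm_weight_insert_ascent[OF \<pi> i, of X Y y w] perm_weight_insert_descent[OF \<pi> i, of X Y y w]
      by (simp add: distrib_right)
    moreover have "fps_deriv (?f i) = (if ?asc i then X * (if ?desc i then y else 1) else 0) +
        (if ?desc i then Y * (if ?asc i then w else 1) else 0)"
      using X Y y w by (simp add: local_weight_def)
    ultimately show ?thesis by simp
  qed
  then have "fps_deriv (perm_weight X Y y w n \<pi>) =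
      (\<Sum>i=1..n. (if ?asc i then ?W i else 0) + (if ?desc i then ?W (i + 1) else 0))"
    unfolding perm_weight_def by (subst fps_deriv_prod) (auto intro!: sum.cong)
  also have "\<dots> = (\<Sum>i=1..n. if ?asc i then ?W i else 0) + (\<Sum>i=1..n. if ?desc i then ?W (i + 1) else 0)"
    by (rule sum.distrib)
  \<comment> \<open>The descents are re-indexed by their lower end; this adds position 1 and drops position n + 1, and neither is entered by a descent.\<close>
  also have "(\<Sum>i=1..n. if ?desc i then ?W (i + 1) else 0) =
      (\<Sum>k=1..n. if ?asc k then 0 else ?W k)"
  proof -
    let ?h = "\<lambda>k. if \<pi> k < \<pi> (k - 1) then ?W k else 0"
    have "(\<Sum>i=1..n. if ?desc i then ?W (i + 1) else 0) = (\<Sum>i=1..n. ?h (i + 1))"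
      by simp
    also have "\<dots> = sum ?h {1 + 1..n + 1}"
      by (rule sum.shift_bounds_cl_nat_ivl[symmetric])
    also have "\<dots> = sum ?h {1..n + 1}"
    proof (intro sum.mono_neutral_left ballI)
      fix k assume "k \<in> {1..n + 1} - {1 + 1..n + 1}"
      then have "k = 1" by auto
      then show "?h k = 0" using b(1) by simp
    qed auto
    also have "\<dots> = sum ?h {1..n}"
      using b(2) b(3)[of n] by simp
    also have "\<dots> = (\<Sum>k=1..n. if ?asc k then 0 else ?W k)"
    proof (intro sum.cong refl)
      fix k assume "k \<in> {1..n}"
      then have "\<pi> k \<noteq> \<pi> (k - 1)" unfolding b(5) by (cases k) auto
      then have "\<pi> k < \<pi> (k - 1) \<longleftrightarrow> \<not> ?asc k" by linarith
      then show "?h k = (if ?asc k then 0 else ?W k)" by simp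
    qed
    finally show ?thesis .
  qed
  also have "(\<Sum>i=1..n. if ?asc i then ?W i else 0) + (\<Sum>k=1..n. if ?asc k then 0 else ?W k) = sum ?W {1..n}"
    unfolding sum.distrib[symmetric] by (intro sum.cong) auto
  finally show ?thesis .
qed

text \<open>
  The factor \<open>z\<close> supplies the remaining insertion: appending the maximum at the end of the word multiplies the
  weight by \<open>w\<close>, which is the logarithmic derivative of \<open>z\<close>.
\<close>
lemma higher_deriv_eq_weight_sum:
  fixes X Y y w z :: "'a::comm_ring_1 fps"
  assumes X: "fps_deriv X = X * y + Y * w" and Y: "fps_deriv Y = X * y + Y * w"
    and y: "fps_deriv y = Y" and w: "fps_deriv w = X" and z: "fps_deriv z = z * w"
  shows "(fps_deriv ^^ n) z = z * (\<Sum>\<pi> | \<pi> permutes {1..n}. perm_weight X Y y w n \<pi>)"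
proof (induction n)
  case 0
  have "{\<pi>. \<pi> permutes {1..0::nat}} = {id}" by auto
  then show ?case by (simp add: perm_weight_def)
next
  case (Suc n)
  let ?S = "{\<pi>. \<pi> permutes {1..n}}"
  let ?W = "\<lambda>\<pi> k. perm_weight X Y y w (n + 1) (insert_max n k \<pi>)"
  have "(fps_deriv ^^ Suc n) z = fps_deriv (z * (\<Sum>\<pi>\<in>?S. perm_weight X Y y w n \<pi>))"
    using Suc by simp
  also have "\<dots> = z * (\<Sum>\<pi>\<in>?S. w * perm_weight X Y y w n \<pi> + fps_deriv (perm_weight X Y y w n \<pi>))"
    by (simp add: z sum.distrib sum_distrib_left fps_deriv_sum algebra_simps)
  also have "(\<Sum>\<pi>\<in>?S. w * perm_weight X Y y w n \<pi> + fps_deriv (perm_weight X Y y w n \<pi>)) =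
      (\<Sum>\<pi>\<in>?S. \<Sum>k=1..n + 1. ?W \<pi> k)"
    using perm_weight_insert_end[of _ n X Y y w] fps_deriv_perm_weight[OF _ X Y y w, of _ n]
    by (intro sum.cong refl) (simp add: add.commute)
  also have "\<dots> = (\<Sum>(\<pi>, k)\<in>?S \<times> {1..n + 1}. ?W \<pi> k)"
    by (rule sum.cartesian_product)
  also have "\<dots> = (\<Sum>\<sigma> | \<sigma> permutes {1..n + 1}. perm_weight X Y y w (n + 1) \<sigma>)"
    by (subst sum.reindex_bij_betw[OF insert_max_bij, symmetric]) (simp add: case_prod_unfold)
  finally show ?case by simp
qed

section \<open>Confluent hypergeometric functions\<close>

text \<open>
  The Taylor series of \<open>hyp1F1 a b\<close> at the origin. Identities between such functions are checked on
  the coefficients and then evaluated, because the radius of convergence is infinite.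
\<close>
definition hyp1F1_fps :: "complex \<Rightarrow> complex \<Rightarrow> complex fps" where
  "hyp1F1_fps a b = Abs_fps (\<lambda>n. pochhammer a n / (pochhammer b n * fact n))"

lemma hyp1F1_eq_eval_fps: "hyp1F1 a b = eval_fps (hyp1F1_fps a b)"
  by (simp add: fun_eq_iff hyp1F1_def eval_fps_def hyp1F1_fps_def)

lemma hyp1F1_0: "hyp1F1 a b 0 = 1"
  by (simp add: hyp1F1_eq_eval_fps eval_fps_at_0 hyp1F1_fps_def)

lemma pochhammer_nonzero_if_notin_nonpos_Ints:
  assumes "b \<notin> \<int>\<^sub>\<le>\<^sub>0"
  shows "pochhammer (b::complex) n \<noteq> 0" "b + of_nat n \<noteq> 0"
proof -
  show "b + of_nat n \<noteq> 0" for n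
    using assms plus_of_nat_eq_0_imp[of b n] by blast
  show "pochhammer b n \<noteq> 0"
    using assms by (auto simp: pochhammer_eq_0_iff)
qed

lemma fps_conv_radius_hyp1F1_fps: "fps_conv_radius (hyp1F1_fps a b) = \<infinity>"
  unfolding fps_conv_radius_def
proof (rule conv_radius_inftyI'')
  fix z :: complex
  let ?c = "\<lambda>n. fps_nth (hyp1F1_fps a b) n * z ^ n"
  \<comment> \<open>From \<open>N\<close> on, \<open>norm (a + n) \<le> 2 n\<close>, \<open>norm (b + n) \<ge> n / 2\<close> and \<open>8 norm z \<le> n + 1\<close>, so the ratio is at most \<open>1 / 2\<close>.\<close>
  define N where "N = nat \<lceil>norm a + 2 * norm b + 8 * norm z + 1\<rceil>"
  show "summable ?c"
  proof (rule summable_ratio_test[of "1/2" N])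
    fix n assume "n \<ge> N"
    then have n: "real n \<ge> norm a + 2 * norm b + 8 * norm z + 1"
      unfolding N_def by linarith
    have nn: "norm a \<ge> 0" "norm b \<ge> 0" "norm z \<ge> 0" by simp_all
    have up: "norm (a + of_nat n) \<le> 2 * real n"
      using norm_triangle_ineq[of a "of_nat n"] n nn by (simp only: norm_of_nat)
    have lo: "norm (b + of_nat n) \<ge> real n / 2"
      using norm_diff_ineq[of "of_nat n" b] n nn by (simp only: norm_of_nat add.commute)
    have pos: "real n > 0" using n nn by linarith
    have "norm ((a + of_nat n) * z) \<le> 2 * real n * norm z"
      using up by (simp add: norm_mult mult_right_mono)
    also have "\<dots> \<le> 1 / 2 * (real n / 2 * (real n + 1))"
    proof -
      have "8 * norm z \<le> real n + 1" using n nn by linarith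
      from mult_left_mono[OF this, of "real n"] show ?thesis by (simp add: algebra_simps)
    qed
    also have "\<dots> \<le> 1 / 2 * (norm (b + of_nat n) * (real n + 1))"
      using lo by (intro mult_left_mono mult_right_mono) auto
    finally have ratio: "norm ((a + of_nat n) * z / ((b + of_nat n) * (of_nat n + 1))) \<le> 1 / 2"
    proof -
      assume *: "norm ((a + of_nat n) * z) \<le> 1 / 2 * (norm (b + of_nat n) * (real n + 1))"
      have "norm ((b + of_nat n) * (of_nat n + 1)) = norm (b + of_nat n) * (real n + 1)"
        unfolding norm_mult by (metis norm_of_nat of_nat_Suc add.commute)
      moreover have "norm (b + of_nat n) * (real n + 1) > 0"
        using lo pos by (intro mult_pos_pos) auto
      ultimately show ?thesis
        using * by (simp add: norm_divide divide_le_eq)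
    qed
    have "?c (Suc n) = (a + of_nat n) * z / ((b + of_nat n) * (of_nat n + 1)) * ?c n"
      by (simp add: hyp1F1_fps_def pochhammer_Suc field_simps)
    then show "norm (?c (Suc n)) \<le> 1 / 2 * norm (?c n)"
      using ratio by (simp only: norm_mult) (rule mult_right_mono, auto)
  qed simp
qed

lemma hyp1F1_derivative:
  assumes b: "b \<notin> \<int>\<^sub>\<le>\<^sub>0"
    and f: "(f has_field_derivative f') (at z within A)"
  shows "((\<lambda>z. hyp1F1 a b (f z)) has_field_derivative a / b * hyp1F1 (a + 1) (b + 1) (f z) * f') (at z within A)"
proof -
  have "fps_deriv (hyp1F1_fps a b) = fps_const (a / b) * hyp1F1_fps (a + 1) (b + 1)"
  proof (rule fps_ext)
    fix n
    show "fps_nth (fps_deriv (hyp1F1_fps a b)) n =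
        fps_nth (fps_const (a / b) * hyp1F1_fps (a + 1) (b + 1)) n"
      using pochhammer_nonzero_if_notin_nonpos_Ints[OF b, of 0]
      by (simp add: hyp1F1_fps_def pochhammer_rec field_simps del: of_nat_Suc)
  qed
  then have "(hyp1F1 a b has_field_derivative a / b * hyp1F1 (a + 1) (b + 1) u) (at u)" for u
    using has_field_derivative_eval_fps[of u "hyp1F1_fps a b" UNIV]
    by (simp add: hyp1F1_eq_eval_fps fps_conv_radius_hyp1F1_fps eval_fps_mult)
  from DERIV_chain2[OF this f] show ?thesis .
qed

text \<open>
  This contiguous relation and the two that follow are what the derivative rule and the
  three-term recurrence of the parabolic cylinder functions reduce to when the even and the odd parts are
  compared, with \<open>b = 1 / 2\<close>.
\<close>
lemma hyp1F1_contiguous_both: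
  assumes b: "b \<notin> \<int>\<^sub>\<le>\<^sub>0"
  shows "b * hyp1F1 a b z - a * hyp1F1 (a + 1) (b + 1) z = (b - a) * hyp1F1 a (b + 1) z"
proof -
  have "fps_const b * hyp1F1_fps a b - fps_const a * hyp1F1_fps (a + 1) (b + 1) =
      fps_const (b - a) * hyp1F1_fps a (b + 1)"
  proof (rule fps_ext)
    fix n
    have "pochhammer b n * (b + of_nat n) = b * pochhammer (b + 1) n"
      using pochhammer_rec[of b n] pochhammer_Suc[of b n] by simp
    moreover have "pochhammer (b + 1) n \<noteq> 0"
      using pochhammer_nonzero_if_notin_nonpos_Ints(1)[OF b, of "Suc n"] by (auto simp: pochhammer_rec)
    ultimately have "b * (pochhammer a n / (pochhammer b n * fact n)) =
        (b + of_nat n) * pochhammer a n / (pochhammer (b + 1) n * fact n)"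
      using pochhammer_nonzero_if_notin_nonpos_Ints[OF b, of n] by (simp add: frac_eq_eq) (simp add: mult_ac)
    moreover have "a * pochhammer (a + 1) n = pochhammer a n * (a + of_nat n)"
      using pochhammer_rec[of a n] pochhammer_Suc[of a n] by simp
    ultimately show "fps_nth (fps_const b * hyp1F1_fps a b - fps_const a * hyp1F1_fps (a + 1) (b + 1)) n =
        fps_nth (fps_const (b - a) * hyp1F1_fps a (b + 1)) n"
      by (simp add: hyp1F1_fps_def diff_divide_distrib[symmetric] algebra_simps)
  qed
  from arg_cong[OF this, of "\<lambda>F. eval_fps F z"] show ?thesis
    by (simp add: hyp1F1_eq_eval_fps fps_conv_radius_hyp1F1_fps eval_fps_mult eval_fps_diff
        less_le_trans[OF _ fps_conv_radius_mult])
qed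

lemma hyp1F1_contiguous_lower:
  assumes b: "b \<notin> \<int>\<^sub>\<le>\<^sub>0"
  shows "hyp1F1 a b z = hyp1F1 a (b + 1) z + z * a / (b * (b + 1)) * hyp1F1 (a + 1) (b + 2) z"
proof -
  have "hyp1F1_fps a b = hyp1F1_fps a (b + 1) + fps_X * (fps_const (a / (b * (b + 1))) * hyp1F1_fps (a + 1) (b + 2))"
  proof (rule fps_ext)
    fix n
    show "fps_nth (hyp1F1_fps a b) n =
      fps_nth (hyp1F1_fps a (b + 1) + fps_X * (fps_const (a / (b * (b + 1))) * hyp1F1_fps (a + 1) (b + 2))) n"
    proof (cases n)
      case (Suc m)
      define P R g where "P = pochhammer (a + 1) m" and "R = pochhammer (b + 2) m" and "g = (fact m :: complex)"
      have nz: "R \<noteq> 0" "b + 1 \<noteq> 0" "b \<noteq> 0" "b + of_nat n \<noteq> 0" "g \<noteq> 0"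
        using pochhammer_nonzero_if_notin_nonpos_Ints(1)[OF b, of "m + 2"] pochhammer_nonzero_if_notin_nonpos_Ints(2)[OF b, of 1]
          pochhammer_nonzero_if_notin_nonpos_Ints(2)[OF b, of 0] pochhammer_nonzero_if_notin_nonpos_Ints(2)[OF b, of n] Suc
        by (auto simp: pochhammer_rec add.assoc R_def g_def)
      have n0: "of_nat n \<noteq> (0::complex)" using Suc by (simp only: of_nat_eq_0_iff)
      have "pochhammer (b + 1) n = (b + 1) * R"
        using pochhammer_rec[of "b + 1" m] Suc by (simp add: R_def add.assoc)
      moreover from this have "pochhammer b n = b * ((b + 1) * R) / (b + of_nat n)"
        using pochhammer_rec[of b n] pochhammer_Suc[of b n] nz(4) by (simp add: eq_divide_eq)
      moreover have "pochhammer a n = a * P"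
        using pochhammer_rec[of a m] Suc by (simp add: P_def)
      moreover have "fact n = of_nat n * g"
        using Suc by (simp add: g_def)
      ultimately have "fps_nth (hyp1F1_fps a b) n = a * P / (b * ((b + 1) * R) / (b + of_nat n) * (of_nat n * g))"
        and "fps_nth (hyp1F1_fps a (b + 1)) n = a * P / ((b + 1) * R * (of_nat n * g))"
        by (simp_all only: hyp1F1_fps_def fps_nth_Abs_fps)
      moreover have "fps_nth (fps_X * (fps_const (a / (b * (b + 1))) * hyp1F1_fps (a + 1) (b + 2))) n =
          a / (b * (b + 1)) * (P / (R * g))"
        using Suc by (simp add: hyp1F1_fps_def P_def R_def g_def)
      moreover have "a * P / (b * ((b + 1) * R) / (b + N) * (N * g)) =
          a * P / ((b + 1) * R * (N * g)) + a / (b * (b + 1)) * (P / (R * g))"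
        if "N \<noteq> 0" "b + N \<noteq> 0" for N
        using nz that by (simp add: divide_simps) (simp add: algebra_simps)
      ultimately show ?thesis
        using nz(4) n0 by (simp only: fps_add_nth)
    qed (simp add: hyp1F1_fps_def)
  qed
  from arg_cong[OF this, of "\<lambda>F. eval_fps F z"] show ?thesis
    by (simp add: hyp1F1_eq_eval_fps fps_conv_radius_hyp1F1_fps eval_fps_mult eval_fps_add
        less_le_trans[OF _ fps_conv_radius_mult])
qed

lemma hyp1F1_contiguous_upper:
  assumes b: "b \<notin> \<int>\<^sub>\<le>\<^sub>0"
  shows "hyp1F1 (a + 1) b z - hyp1F1 a b z = z / b * hyp1F1 (a + 1) (b + 1) z"
proof -
  have "hyp1F1_fps (a + 1) b = hyp1F1_fps a b + fps_X * (fps_const (1 / b) * hyp1F1_fps (a + 1) (b + 1))"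
  proof (rule fps_ext)
    fix n
    show "fps_nth (hyp1F1_fps (a + 1) b) n =
      fps_nth (hyp1F1_fps a b + fps_X * (fps_const (1 / b) * hyp1F1_fps (a + 1) (b + 1))) n"
    proof (cases n)
      case (Suc m)
      have "pochhammer a n = a * pochhammer (a + 1) m"
        "pochhammer (a + 1) n = pochhammer (a + 1) m * (a + of_nat n)"
        "pochhammer b n = b * pochhammer (b + 1) m"
        using pochhammer_rec[of a m] pochhammer_rec[of b m] pochhammer_Suc[of "a + 1" m] Suc
        by (simp_all add: field_simps)
      moreover have "fact n = of_nat n * (fact m :: complex)"
        using Suc by simp
      moreover have "pochhammer (b + 1) m \<noteq> 0" "b \<noteq> 0"
        using pochhammer_nonzero_if_notin_nonpos_Ints(1)[OF b, of "m + 1"] pochhammer_nonzero_if_notin_nonpos_Ints(2)[OF b, of 0]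
        by (auto simp: pochhammer_rec add.assoc)
      ultimately show ?thesis
        using Suc
        by (simp add: hyp1F1_fps_def divide_simps del: of_nat_Suc) (simp add: algebra_simps)
    qed (simp add: hyp1F1_fps_def)
  qed
  from arg_cong[OF this, of "\<lambda>F. eval_fps F z"] show ?thesis
    by (simp add: hyp1F1_eq_eval_fps fps_conv_radius_hyp1F1_fps eval_fps_mult eval_fps_add
        less_le_trans[OF _ fps_conv_radius_mult])
qed

section \<open>Parabolic cylinder functions\<close>

lemma half_integers_notin_nonpos_Ints: "(1 / 2 :: complex) \<notin> \<int>\<^sub>\<le>\<^sub>0" "(3 / 2 :: complex) \<notin> \<int>\<^sub>\<le>\<^sub>0"
proof -
  have "q \<notin> \<int>\<^sub>\<le>\<^sub>0" if "Re q > 0" for q :: complex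
    using that by (auto elim!: nonpos_Ints_cases)
  then show "(1 / 2 :: complex) \<notin> \<int>\<^sub>\<le>\<^sub>0" "(3 / 2 :: complex) \<notin> \<int>\<^sub>\<le>\<^sub>0"
    by simp_all
qed

definition cylinder_const :: "complex \<Rightarrow> complex" where
  "cylinder_const a = 2 powr (a / 2) * of_real (sqrt pi)"

lemma cylinder_const_shift: "cylinder_const (a + 1) = of_real (sqrt 2) * cylinder_const a"
proof -
  have "(2::complex) powr (1 / 2) = of_real (2 powr (1 / 2))"
    using powr_of_real[of 2 "1 / 2"] by simp
  then show ?thesis
    by (simp add: cylinder_const_def add_divide_distrib powr_add powr_half_sqrt)
qed

lemma cylinder_const_minus: "cylinder_const a * cylinder_const (- a) = of_real pi"
proof -
  have "cylinder_const a * cylinder_const (- a) = of_real (sqrt pi) * of_real (sqrt pi) * (2 powr (a / 2) * 2 powr (- (a / 2)))"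
    by (simp add: cylinder_const_def)
  also have "2 powr (a / 2) * 2 powr (- (a / 2)) = (1::complex)"
    by (simp add: powr_minus)
  also have "complex_of_real (sqrt pi) * of_real (sqrt pi) = of_real pi"
    by (simp flip: of_real_mult)
  finally show ?thesis by simp
qed

text \<open>
  The Hermite function \<open>He\<^sub>a\<close> in the probabilists' normalisation (\<open>He\<^sub>0 = 1\<close>), extended to complex order. It is
  the parabolic cylinder function without its Gaussian factor.
\<close>
definition hermite_function :: "complex \<Rightarrow> complex \<Rightarrow> complex" where
  "hermite_function a z = cylinder_const a *
     (rGamma ((1 - a) / 2) * hyp1F1 (- a / 2) (1 / 2) (z ^ 2 / 2)
      - of_real (sqrt 2) * z * rGamma (- a / 2) * hyp1F1 ((1 - a) / 2) (3 / 2) (z ^ 2 / 2))"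

lemma parabolic_cylinder_eq_hermite_function:
  "parabolic_cylinder a z = exp (- (z ^ 2) / 4) * hermite_function a z"
  by (simp add: parabolic_cylinder_def hermite_function_def cylinder_const_def mult_ac)

lemma rGamma_shifts:
  "rGamma (- a / 2) = - (a / 2) * rGamma ((2 - a) / 2)"
  "rGamma (- (a + 1) / 2) = - ((a + 1) / 2) * rGamma ((1 - a) / 2 :: complex)"
  using rGamma_plus1[of "- a / 2"] rGamma_plus1[of "- (a + 1) / 2"]
  by (simp_all add: field_simps)

lemma sqrt2_square: "complex_of_real (sqrt 2) * complex_of_real (sqrt 2) = 2"
  by (simp flip: of_real_mult)

text \<open>
  The functions of three consecutive orders in terms of the same two Gamma factors \<open>G0\<close> and \<open>G1\<close>: by the functional
  equation of \<open>1/\<Gamma>\<close> the even part of one order and the odd parts of the neighbouring orders share a factor. No division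
  occurs, so the relations stay valid where \<open>1/\<Gamma>\<close> vanishes.
\<close>
lemma hermite_function_split:
  fixes a z :: complex
  defines "\<phi> \<equiv> \<lambda>a. hyp1F1 (- a / 2) (1 / 2) (z ^ 2 / 2)"
    and "\<psi> \<equiv> \<lambda>a. hyp1F1 ((1 - a) / 2) (3 / 2) (z ^ 2 / 2)"
    and "K \<equiv> cylinder_const (a - 1)" and "t \<equiv> complex_of_real (sqrt 2)"
    and "G0 \<equiv> rGamma ((1 - a) / 2)" and "G1 \<equiv> rGamma ((2 - a) / 2)"
  shows "hermite_function (a - 1) z = K * (G1 * \<phi> (a - 1) - t * z * G0 * \<psi> (a - 1))"
    "hermite_function a z = K * (t * G0 * \<phi> a + a * z * G1 * \<psi> a)"
    "hermite_function (a + 1) z = K * (t * (a + 1) * z * G0 * \<psi> (a + 1) - a * G1 * \<phi> (a + 1))"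
proof -
  have K: "cylinder_const a = t * K" "cylinder_const (a + 1) = t * (t * K)"
    using cylinder_const_shift[of "a - 1"] cylinder_const_shift[of a] by (simp_all add: K_def t_def)
  have t: "t * t = 2" using sqrt2_square by (simp add: t_def)
  show "hermite_function (a - 1) z = K * (G1 * \<phi> (a - 1) - t * z * G0 * \<psi> (a - 1))"
  proof -
    have "rGamma ((1 - (a - 1)) / 2) = G1" "rGamma (- (a - 1) / 2) = G0"
      by (simp_all add: G0_def G1_def algebra_simps)
    then show ?thesis
      by (simp only: hermite_function_def \<phi>_def \<psi>_def K_def t_def)
  qed
  have "hermite_function a z = t * K * (G0 * \<phi> a - t * z * (- (a / 2) * G1) * \<psi> a)"
    by (simp only: hermite_function_def \<phi>_def \<psi>_def K t_def[symmetric] rGamma_shifts G0_def G1_def)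
  also have "\<dots> = K * (t * G0 * \<phi> a + (t * t) * (a / 2) * z * G1 * \<psi> a)"
    by (simp add: algebra_simps)
  finally show "hermite_function a z = K * (t * G0 * \<phi> a + a * z * G1 * \<psi> a)"
    by (simp add: t)
  have r: "rGamma ((1 - (a + 1)) / 2) = - (a / 2) * G1" "rGamma (- (a + 1) / 2) = - ((a + 1) / 2) * G0"
    using rGamma_shifts[of a] by (simp_all add: G0_def G1_def)
  have "hermite_function (a + 1) z = t * (t * K) * (- (a / 2) * G1 * \<phi> (a + 1)
      - t * z * (- ((a + 1) / 2) * G0) * \<psi> (a + 1))"
    by (simp only: hermite_function_def \<phi>_def \<psi>_def K t_def[symmetric] r)
  also have "t * (t * K) = t * t * K" by (simp only: mult.assoc)
  also have "\<dots> * (- (a / 2) * G1 * \<phi> (a + 1) - t * z * (- ((a + 1) / 2) * G0) * \<psi> (a + 1))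
      = K * (t * (a + 1) * z * G0 * \<psi> (a + 1) - a * G1 * \<phi> (a + 1))"
    unfolding t by (simp add: algebra_simps)
  finally show "hermite_function (a + 1) z = K * (t * (a + 1) * z * G0 * \<psi> (a + 1) - a * G1 * \<phi> (a + 1))" .
qed

lemma hermite_function_derivative:
  "(hermite_function a has_field_derivative a * hermite_function (a - 1) z) (at z)"
proof -
  let ?\<phi> = "\<lambda>a z. hyp1F1 (- a / 2) (1 / 2) (z ^ 2 / 2)"
  let ?\<psi> = "\<lambda>a z. hyp1F1 ((1 - a) / 2) (3 / 2) (z ^ 2 / 2)"
  let ?K = "cylinder_const (a - 1)" and ?t = "complex_of_real (sqrt 2)"
  let ?G0 = "rGamma ((1 - a) / 2)" and ?G1 = "rGamma ((2 - a) / 2)"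
  have sq: "((\<lambda>z. z ^ 2 / 2) has_field_derivative z) (at z)" for z :: complex
    by (auto intro!: derivative_eq_intros)
  have \<phi>': "(?\<phi> a has_field_derivative - a * z * ?\<psi> (a - 1) z) (at z)"
  proof -
    have e: "- a / 2 + 1 = (1 - (a - 1)) / 2" "1 / 2 + 1 = (3 / 2 :: complex)"
      by (simp_all add: field_simps)
    show ?thesis
      using hyp1F1_derivative[OF half_integers_notin_nonpos_Ints(1) sq, of "- a / 2" z]
      unfolding e by (simp add: mult_ac)
  qed
  have \<psi>': "((\<lambda>z. z * ?\<psi> a z) has_field_derivative ?\<phi> (a - 1) z) (at z)"
  proof -
    have e: "- (a - 1) / 2 = (1 - a) / 2" "1 / 2 + 1 = (3 / 2 :: complex)" "1 / 2 + 2 = (3 / 2 + 1 :: complex)"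
      by (simp_all add: field_simps)
    have "((\<lambda>z. z * ?\<psi> a z) has_field_derivative
        z * ((1 - a) / 2 / (3 / 2) * hyp1F1 ((1 - a) / 2 + 1) (3 / 2 + 1) (z ^ 2 / 2) * z) + 1 * ?\<psi> a z) (at z)"
      by (rule DERIV_mult'[OF DERIV_ident hyp1F1_derivative[OF half_integers_notin_nonpos_Ints(2) sq]])
    also have "z * ((1 - a) / 2 / (3 / 2) * hyp1F1 ((1 - a) / 2 + 1) (3 / 2 + 1) (z ^ 2 / 2) * z) + 1 * ?\<psi> a z
        = ?\<psi> a z + z ^ 2 / 2 * ((1 - a) / 2) / (1 / 2 * (3 / 2)) * hyp1F1 ((1 - a) / 2 + 1) (3 / 2 + 1) (z ^ 2 / 2)"
      by (simp add: power2_eq_square)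
    also have "\<dots> = ?\<phi> (a - 1) z"
      using hyp1F1_contiguous_lower[OF half_integers_notin_nonpos_Ints(1), of "(1 - a) / 2" "z ^ 2 / 2"]
      unfolding e by (rule sym)
    finally show ?thesis .
  qed
  have "hermite_function a = (\<lambda>z. ?K * (?t * ?G0 * ?\<phi> a z + a * ?G1 * (z * ?\<psi> a z)))"
    by (simp add: fun_eq_iff hermite_function_split(2) mult_ac)
  moreover have "((\<lambda>z. ?K * (?t * ?G0 * ?\<phi> a z + a * ?G1 * (z * ?\<psi> a z))) has_field_derivative
      ?K * (?t * ?G0 * (- a * z * ?\<psi> (a - 1) z) + a * ?G1 * ?\<phi> (a - 1) z)) (at z)"
    by (intro DERIV_cmult DERIV_add \<phi>' \<psi>')
  moreover have "?K * (?t * ?G0 * (- a * z * ?\<psi> (a - 1) z) + a * ?G1 * ?\<phi> (a - 1) z) =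
      a * hermite_function (a - 1) z"
    by (simp add: hermite_function_split(1) algebra_simps)
  ultimately show ?thesis by simp
qed

lemma hermite_function_recurrence:
  "hermite_function (a + 1) z = z * hermite_function a z - a * hermite_function (a - 1) z"
proof -
  let ?\<phi> = "\<lambda>a. hyp1F1 (- a / 2) (1 / 2) (z ^ 2 / 2)"
  let ?\<psi> = "\<lambda>a. hyp1F1 ((1 - a) / 2) (3 / 2) (z ^ 2 / 2)"
  have odd: "(a + 1) * ?\<psi> (a + 1) = ?\<phi> a + a * ?\<psi> (a - 1)"
  proof -
    have e: "- a / 2 + 1 = (1 - (a - 1)) / 2" "(1 - (a + 1)) / 2 = - a / 2" "1 / 2 + 1 = (3 / 2 :: complex)"
      by (simp_all add: field_simps)
    have "(a + 1) * ?\<psi> (a + 1) = 2 * ((1 / 2 - - a / 2) * ?\<psi> (a + 1))"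
      by (simp add: algebra_simps)
    also have "(1 / 2 - - a / 2) * ?\<psi> (a + 1) = 1 / 2 * ?\<phi> a - - a / 2 * ?\<psi> (a - 1)"
      using hyp1F1_contiguous_both[OF half_integers_notin_nonpos_Ints(1), of "- a / 2" "z ^ 2 / 2"]
      unfolding e by (rule sym)
    also have "2 * \<dots> = ?\<phi> a + a * ?\<psi> (a - 1)"
      by (simp add: algebra_simps)
    finally show ?thesis .
  qed
  have even: "?\<phi> (a + 1) = ?\<phi> (a - 1) - z ^ 2 * ?\<psi> a"
  proof -
    have e: "- (a + 1) / 2 + 1 = (1 - a) / 2" "- (a - 1) / 2 = (1 - a) / 2" "1 / 2 + 1 = (3 / 2 :: complex)"
      by (simp_all add: field_simps)
    have "?\<phi> (a - 1) - ?\<phi> (a + 1) = z ^ 2 / 2 / (1 / 2) * ?\<psi> a"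
      using hyp1F1_contiguous_upper[OF half_integers_notin_nonpos_Ints(1), of "- (a + 1) / 2" "z ^ 2 / 2"]
      unfolding e .
    then show ?thesis by (simp add: algebra_simps)
  qed
  have "hermite_function (a + 1) z = cylinder_const (a - 1) *
      (of_real (sqrt 2) * z * rGamma ((1 - a) / 2) * ((a + 1) * ?\<psi> (a + 1))
       - a * rGamma ((2 - a) / 2) * ?\<phi> (a + 1))"
    unfolding hermite_function_split(3) by (simp add: mult_ac)
  also have "\<dots> = z * hermite_function a z - a * hermite_function (a - 1) z"
    unfolding odd even hermite_function_split(1)[of a z] hermite_function_split(2)[of a z] by (simp add: algebra_simps power2_eq_square)
  finally show ?thesis .
qed

text \<open>
  The two ladder relations express the derivative through the next lower or the next higher order. Applying one after
  the other gives Weber's equation \<open>D'' = (z\<^sup>2 / 4 - a - 1 / 2) D\<close>.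
\<close>
lemma parabolic_cylinder_derivative_lower:
  assumes "(f has_field_derivative f') (at t)"
  shows "((\<lambda>t. parabolic_cylinder a (f t)) has_field_derivative
     (a * parabolic_cylinder (a - 1) (f t) - f t / 2 * parabolic_cylinder a (f t)) * f') (at t)"
proof -
  have "((\<lambda>z. exp (- (z ^ 2) / 4) * hermite_function a z) has_field_derivative
      exp (- (z ^ 2) / 4) * (a * hermite_function (a - 1) z) +
      exp (- (z ^ 2) / 4) * (- (z / 2)) * hermite_function a z) (at z)" for z
    by (rule DERIV_mult'[OF _ hermite_function_derivative]) (auto intro!: derivative_eq_intros)
  then have "(parabolic_cylinder a has_field_derivative
     a * parabolic_cylinder (a - 1) z - z / 2 * parabolic_cylinder a z) (at z)" for z
    by (simp add: parabolic_cylinder_eq_hermite_function[abs_def] algebra_simps)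
  from DERIV_chain2[OF this assms] show ?thesis .
qed

lemma parabolic_cylinder_recurrence:
  "parabolic_cylinder (a + 1) z = z * parabolic_cylinder a z - a * parabolic_cylinder (a - 1) z"
  unfolding parabolic_cylinder_eq_hermite_function hermite_function_recurrence
  by (simp add: algebra_simps)

lemma parabolic_cylinder_derivative_raise:
  assumes "(f has_field_derivative f') (at t)"
  shows "((\<lambda>t. parabolic_cylinder a (f t)) has_field_derivative
     (f t / 2 * parabolic_cylinder a (f t) - parabolic_cylinder (a + 1) (f t)) * f') (at t)"
proof (rule DERIV_cong[OF parabolic_cylinder_derivative_lower[OF assms, of a]])
  show "(a * parabolic_cylinder (a - 1) (f t) - f t / 2 * parabolic_cylinder a (f t)) * f' =
      (f t / 2 * parabolic_cylinder a (f t) - parabolic_cylinder (a + 1) (f t)) * f'"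
    unfolding parabolic_cylinder_recurrence[of a] by (simp add: field_simps)
qed

lemma parabolic_cylinder_at_0:
  "parabolic_cylinder a 0 = cylinder_const a * rGamma ((1 - a) / 2)"
  by (simp add: parabolic_cylinder_def cylinder_const_def hyp1F1_0)

text \<open>
  The left-hand side is the Wronskian of the solutions \<open>D\<^sub>a(z)\<close> and \<open>D\<^sub>-\<^sub>a\<^sub>-\<^sub>1(\<i> z)\<close> of the same Weber equation, with the
  derivatives eliminated by the raising relation. Hence it is constant, and its value at \<open>0\<close> follows from the
  reflection formula of the Gamma function. Being an exponential, it never vanishes.
\<close>
lemma parabolic_cylinder_wronskian:
  "parabolic_cylinder (a + 1) z * parabolic_cylinder (- a - 1) (\<i> * z)
   - \<i> * parabolic_cylinder a z * parabolic_cylinder (- a) (\<i> * z)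
   - z * parabolic_cylinder a z * parabolic_cylinder (- a - 1) (\<i> * z) = - \<i> * exp (- \<i> * (of_real pi * a / 2))"
  (is "?W z = _")
proof -
  have "(?W has_field_derivative 0) (at z)" for z
  proof -
    have iz: "((\<lambda>z. \<i> * z) has_field_derivative \<i>) (at z)"
      by (auto intro!: derivative_eq_intros)
    have A: "(parabolic_cylinder a has_field_derivative
        z / 2 * parabolic_cylinder a z - parabolic_cylinder (a + 1) z) (at z)"
      using parabolic_cylinder_derivative_raise[OF DERIV_ident, of a] by simp
    have A1: "(parabolic_cylinder (a + 1) has_field_derivative
        (a + 1) * parabolic_cylinder a z - z / 2 * parabolic_cylinder (a + 1) z) (at z)"
      using parabolic_cylinder_derivative_lower[OF DERIV_ident, of "a + 1"] by simp
    have B: "((\<lambda>z. parabolic_cylinder (- a - 1) (\<i> * z)) has_field_derivative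
        (\<i> * z / 2 * parabolic_cylinder (- a - 1) (\<i> * z) - parabolic_cylinder (- a) (\<i> * z)) * \<i>) (at z)"
      using parabolic_cylinder_derivative_raise[OF iz, of "- a - 1"] by simp
    have B1: "((\<lambda>z. parabolic_cylinder (- a) (\<i> * z)) has_field_derivative
        (- a * parabolic_cylinder (- a - 1) (\<i> * z) - \<i> * z / 2 * parabolic_cylinder (- a) (\<i> * z)) * \<i>) (at z)"
      using parabolic_cylinder_derivative_lower[OF iz, of "- a"] by simp
    show ?thesis
      by (rule DERIV_cong[OF DERIV_diff[OF DERIV_diff[OF DERIV_mult'[OF A1 B]
            DERIV_mult'[OF DERIV_cmult[OF A, of \<i>] B1]]
            DERIV_mult'[OF DERIV_mult'[OF DERIV_ident A] B]]]) (simp add: algebra_simps)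
  qed
  then obtain c where c: "\<And>z. ?W z = c"
    using has_field_derivative_zero_constant[of UNIV ?W] by auto
  have "?W z = ?W 0" by (rule trans[OF c c[symmetric]])
  also have "?W 0 = (cylinder_const (a + 1) * cylinder_const (- (a + 1))) * (rGamma (- a / 2) * rGamma (1 - - a / 2))
      - \<i> * ((cylinder_const a * cylinder_const (- a)) * (rGamma ((1 - a) / 2) * rGamma (1 - (1 - a) / 2)))"
  proof -
    have e: "1 - - a / 2 = (1 - (- (a + 1))) / 2" "1 - (1 - a) / 2 = (1 - - a) / 2" "(1 - (a + 1)) / 2 = - a / 2"
      by (simp_all add: field_simps)
    have "- a - 1 = - (a + 1)" by simp
    then show ?thesis unfolding e parabolic_cylinder_at_0 mult_zero_right e(3) by (simp add: parabolic_cylinder_at_0 mult_ac)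
  qed
  also have "\<dots> = sin (of_real pi * (- a / 2)) - \<i> * sin (of_real pi * ((1 - a) / 2))"
    unfolding cylinder_const_minus rGamma_reflection_complex by simp
  also have "of_real pi * ((1 - a) / 2) = of_real pi / 2 - of_real pi * a / 2"
    by (simp add: algebra_simps diff_divide_distrib)
  also have "sin \<dots> = cos (of_real pi * a / 2)"
    by (simp add: sin_diff)
  also have "sin (of_real pi * (- a / 2)) - \<i> * cos (of_real pi * a / 2) = - \<i> * exp (- \<i> * (of_real pi * a / 2))"
  proof -
    have "exp (- \<i> * (of_real pi * a / 2)) = cos (of_real pi * a / 2) - \<i> * sin (of_real pi * a / 2)"
      using exp_Euler[of "- (of_real pi * a / 2)"] by simp
    then show ?thesis by (simp only:) (simp add: algebra_simps)
  qed
  finally show ?thesis .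
qed

section \<open>The generating function\<close>

lemma perm_poly_eq_weight_sum:
  "perm_poly n x y z w u v =
     z * (\<Sum>\<pi> | \<pi> permutes {1..n}. perm_weight (x * v) (z * u) y w n \<pi>)"
  unfolding perm_poly_def sum_distrib_left
  by (intro sum.cong refl) (simp add: perm_weight_eq_statistics power_mult_distrib mult_ac)

lemma fps_nth_0_prod:
  fixes f :: "'b \<Rightarrow> 'a::comm_semiring_1 fps"
  shows "fps_nth (prod f A) 0 = (\<Prod>i\<in>A. fps_nth (f i) 0)"
  by (induction A rule: infinite_finite_induct) auto

lemma fps_nth_0_perm_weight:
  "fps_nth (perm_weight X Y y w n \<pi>) 0 =
     perm_weight (fps_nth X 0) (fps_nth Y 0) (fps_nth y 0) (fps_nth w 0) n \<pi>"
  unfolding perm_weight_def fps_nth_0_prod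
  by (intro prod.cong refl) (simp add: local_weight_def)

text \<open>
  From a solution \<open>k\<close> of the linear equation one obtains power series \<open>Z\<close>, \<open>W\<close>, \<open>V\<close>, \<open>X\<close>, \<open>Y\<close> that solve the system
  of the insertion calculus with initial values \<open>z\<close>, \<open>w\<close>, \<open>y\<close>, \<open>x v\<close>, \<open>z u\<close>. The \<open>n\<close>-th derivative of \<open>Z\<close> at \<open>0\<close> is
  then both \<open>n!\<close> times its coefficient and the weight sum over the permutations of \<open>{1..n}\<close>.
\<close>
lemma perm_poly_fps_eq_reciprocal:
  fixes k :: "complex fps" and x y z w u v :: complex
  assumes ode: "fps_deriv (fps_deriv k) + (fps_const (w - y) + fps_const (x * v - z * u) * fps_X) * fps_deriv k
      + fps_const (x * v - y * w) * k = 0"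
    and k0: "fps_nth k 0 = 1" and k1: "fps_nth (fps_deriv k) 0 = - w"
  shows "fps_const z * inverse k = Abs_fps (\<lambda>n. perm_poly n x y z w u v / fact n)"
proof (rule fps_ext)
  fix n
  define j where "j = inverse k"
  \<comment> \<open>The choices are forced by the system: X - Y and X - W V are constant along solutions, and W - V has derivative X - Y.\<close>
  define C where "C = fps_const (w - y) + fps_const (x * v - z * u) * (fps_X :: complex fps)"
  define W where "W = - fps_deriv k * j"
  define V where "V = W - C"
  define X where "X = W * V + fps_const (x * v - y * w)"
  define Y where "Y = X - fps_const (x * v - z * u)"
  define Z where "Z = fps_const z * j"
  have kj: "k * j = 1" unfolding j_def using k0 by (intro inverse_mult_eq_1') simp
  have j': "fps_deriv j = - fps_deriv k * j ^ 2"
    unfolding j_def using k0 by (intro fps_inverse_deriv) simp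
  have C': "fps_deriv C = fps_const (x * v - z * u)" by (simp add: C_def)
  have k2: "fps_deriv (fps_deriv k) = - (C * fps_deriv k) - fps_const (x * v - y * w) * k"
    using ode unfolding C_def by (simp add: algebra_simps eq_neg_iff_add_eq_0)
  have W': "fps_deriv W = X"
  proof -
    have "fps_deriv W = - (fps_deriv (fps_deriv k) * j) + W * W"
      by (simp add: W_def j' power2_eq_square algebra_simps)
    also have "\<dots> = - (C * W) + fps_const (x * v - y * w) * (k * j) + W * W"
      unfolding k2 by (simp add: W_def algebra_simps)
    also have "\<dots> = X" unfolding kj by (simp add: X_def V_def algebra_simps)
    finally show ?thesis .
  qed
  have V': "fps_deriv V = Y" by (simp add: V_def W' C' Y_def)
  have X': "fps_deriv X = X * V + Y * W" by (simp add: X_def[THEN arg_cong[where f = fps_deriv]] W' V' algebra_simps)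
  have Y': "fps_deriv Y = X * V + Y * W" by (simp add: Y_def X'[unfolded Y_def])
  have Z': "fps_deriv Z = Z * W" by (simp add: Z_def j' W_def power2_eq_square algebra_simps)
  have init: "fps_nth W 0 = w" "fps_nth V 0 = y" "fps_nth X 0 = x * v" "fps_nth Y 0 = z * u" "fps_nth Z 0 = z"
  proof -
    have j0: "fps_nth j 0 = 1" by (simp add: j_def k0)
    show W0: "fps_nth W 0 = w" using k1 j0 by (simp add: W_def)
    show V0: "fps_nth V 0 = y" using W0 by (simp add: V_def C_def)
    show X0: "fps_nth X 0 = x * v" using W0 V0 by (simp add: X_def)
    show "fps_nth Y 0 = z * u" using X0 by (simp add: Y_def)
    show "fps_nth Z 0 = z" using j0 by (simp add: Z_def)
  qed
  have "fact n * fps_nth Z n = fps_nth ((fps_deriv ^^ n) Z) 0"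
    by (simp add: fps_0th_higher_deriv)
  also have "\<dots> = perm_poly n x y z w u v"
    unfolding higher_deriv_eq_weight_sum[OF X' Y' V' W' Z']
    by (simp add: fps_sum_nth fps_nth_0_perm_weight init perm_poly_eq_weight_sum)
  finally show "fps_nth (fps_const z * inverse k) n =
      fps_nth (Abs_fps (\<lambda>n. perm_poly n x y z w u v / fact n)) n"
    by (simp add: Z_def j_def field_simps)
qed

text \<open>
  The same with an entire solution \<open>K\<close>, whose Taylor series inherits the linear equation.
\<close>
lemma perm_poly_egf_eq_reciprocal:
  fixes K K1 :: "complex \<Rightarrow> complex" and x y z w u v :: complex
  assumes K: "\<And>t. (K has_field_derivative K1 t) (at t)"
    and K1: "\<And>t. (K1 has_field_derivative
      - ((w - y + (x * v - z * u) * t) * K1 t) - (x * v - y * w) * K t) (at t)"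
    and K0: "K 0 = 1" and K10: "K1 0 = - w"
  shows "(\<lambda>t. z / K t) has_fps_expansion Abs_fps (\<lambda>n. perm_poly n x y z w u v / fact n)"
proof -
  define k where "k = fps_expansion K 0"
  have "K holomorphic_on UNIV"
    using K by (auto simp: holomorphic_on_open)
  then have k: "K has_fps_expansion k"
    unfolding k_def by (intro has_fps_expansion_fps_expansion[of UNIV]) auto
  have dK: "deriv K = K1" and dK1: "deriv K1 = (\<lambda>t. - ((w - y + (x * v - z * u) * t) * K1 t) - (x * v - y * w) * K t)"
    using K K1 by (auto intro!: DERIV_imp_deriv)
  have k': "K1 has_fps_expansion fps_deriv k"
    using has_fps_expansion_deriv[OF k] unfolding dK .
  have k'': "(\<lambda>t. - ((w - y + (x * v - z * u) * t) * K1 t) - (x * v - y * w) * K t) has_fps_expansion fps_deriv (fps_deriv k)"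
    using has_fps_expansion_deriv[OF k'] unfolding dK1 .
  have "(\<lambda>t. - ((w - y + (x * v - z * u) * t) * K1 t) - (x * v - y * w) * K t) has_fps_expansion
      - ((fps_const (w - y) + fps_const (x * v - z * u) * fps_X) * fps_deriv k) - fps_const (x * v - y * w) * k"
    by (intro fps_expansion_intros k k')
  from fps_expansion_unique_complex[OF k'' this]
  have ode: "fps_deriv (fps_deriv k) + (fps_const (w - y) + fps_const (x * v - z * u) * fps_X) * fps_deriv k
      + fps_const (x * v - y * w) * k = 0"
    by simp
  have k0: "fps_nth k 0 = 1"
    using has_fps_expansion_imp_0_eq_fps_nth_0[OF k] K0 by simp
  have k1: "fps_nth (fps_deriv k) 0 = - w"
    using has_fps_expansion_imp_0_eq_fps_nth_0[OF k'] K10 by simp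
  have "(\<lambda>t. z * inverse (K t)) has_fps_expansion fps_const z * inverse k"
    using k0 by (intro fps_expansion_intros k) simp
  then show ?thesis
    unfolding perm_poly_fps_eq_reciprocal[OF ode k0 k1] by (simp add: divide_inverse)
qed

theorem theorem1p5:
  fixes x y z w u v \<delta> \<delta>' p q r s :: complex
  assumes "x * v \<noteq> z * u"
    and "\<delta> ^ 2 = x * v - z * u"
    and "\<delta>' ^ 2 = z * u - x * v"
    and "\<delta>' = \<i> * \<delta>"
    and "p = parabolic_cylinder ((z * u - y * w) / \<delta> ^ 2) ((w - y) / \<delta>)"
    and "q = parabolic_cylinder ((x * v - y * w) / \<delta>' ^ 2) ((y - w) / \<delta>')"
    and "r = parabolic_cylinder ((x * v - y * w) / \<delta> ^ 2) ((w - y) / \<delta>)"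
    and "s = parabolic_cylinder ((z * u - y * w) / \<delta>' ^ 2) ((y - w) / \<delta>')"
  shows "(\<lambda>t. z * (p * q * (w - y) + (\<delta>' * p * s - \<delta> * q * r)) *
                exp ((w - y) / 2 * t + \<delta> ^ 2 / 4 * t ^ 2) /
              ((\<delta>' * s - q * y) *
                 parabolic_cylinder ((z * u - y * w) / \<delta> ^ 2) (\<delta> * t + (w - y) / \<delta>)
               + (p * w - \<delta> * r) *
                 parabolic_cylinder ((x * v - y * w) / \<delta>' ^ 2) (\<delta>' * t + (y - w) / \<delta>')))
         has_fps_expansion Abs_fps (\<lambda>n. perm_poly n x y z w u v / fact n)"
proof -
  define a where "a = (z * u - y * w) / \<delta> ^ 2"
  define N where "N = p * q * (w - y) + (\<delta>' * p * s - \<delta> * q * r)"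
  define A where "A = \<delta>' * s - q * y"
  define B where "B = p * w - \<delta> * r"
  \<comment> \<open>Both cylinder functions have arguments on one line: the second argument is \<open>\<i> * \<zeta> t\<close>, and its order is \<open>- a - 1\<close>.\<close>
  define \<zeta> where "\<zeta> = (\<lambda>t. \<delta> * t + (w - y) / \<delta>)"
  define f where "f = (\<lambda>t. parabolic_cylinder a (\<zeta> t))"
  define g where "g = (\<lambda>t. parabolic_cylinder (- a - 1) (\<i> * \<zeta> t))"
  define f1 where "f1 = (\<lambda>t. (\<zeta> t / 2 * f t - parabolic_cylinder (a + 1) (\<zeta> t)) * \<delta>)"
  define g1 where "g1 = (\<lambda>t. (\<i> * \<zeta> t / 2 * g t - parabolic_cylinder (- a) (\<i> * \<zeta> t)) * (\<i> * \<delta>))"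
  define \<phi> where "\<phi> = (\<lambda>t. (w - y) / 2 * t + \<delta> ^ 2 / 4 * t ^ 2)"
  have d: "\<delta> \<noteq> 0" using assms(1,2) by auto
  have D: "x * v - z * u = \<delta> ^ 2" using assms(2) by simp
  have d2: "\<delta>' ^ 2 = - (\<delta> ^ 2)" using assms(2,3) by simp
  have aD: "z * u - y * w = a * \<delta> ^ 2" using d by (simp add: a_def)
  then have xD: "x * v - y * w = (a + 1) * \<delta> ^ 2" using D by (simp add: algebra_simps)
  have par: "(z * u - y * w) / \<delta> ^ 2 = a" "(x * v - y * w) / \<delta> ^ 2 = a + 1"
    "(x * v - y * w) / \<delta>' ^ 2 = - a - 1" "(z * u - y * w) / \<delta>' ^ 2 = - a"
    unfolding d2 aD xD using d by simp_all
  have arg: "\<delta>' * t + (y - w) / \<delta>' = \<i> * \<zeta> t" for t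
    unfolding assms(4) \<zeta>_def using d by (simp add: field_simps)
  have arg0: "(w - y) / \<delta> = \<zeta> 0" "(y - w) / \<delta>' = \<i> * \<zeta> 0"
    using arg[of 0] by (simp_all add: \<zeta>_def)
  have \<delta>\<zeta>: "\<delta> * \<zeta> t = \<delta> ^ 2 * t + (w - y)" for t
    using d by (simp add: \<zeta>_def distrib_left power2_eq_square mult.assoc)
  have pqrs: "p = f 0" "q = g 0" "r = parabolic_cylinder (a + 1) (\<zeta> 0)" "s = parabolic_cylinder (- a) (\<i> * \<zeta> 0)"
    unfolding assms(5-8) par arg0 f_def g_def by simp_all
  have \<zeta>': "(\<zeta> has_field_derivative \<delta>) (at t)" and i\<zeta>': "((\<lambda>t. \<i> * \<zeta> t) has_field_derivative \<i> * \<delta>) (at t)" for t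
    by (auto simp: \<zeta>_def intro!: derivative_eq_intros)
  have \<phi>': "(\<phi> has_field_derivative \<delta> * \<zeta> t / 2) (at t)" for t
    unfolding \<delta>\<zeta> \<phi>_def by (auto intro!: derivative_eq_intros simp: field_simps)

  have f': "(f has_field_derivative f1 t) (at t)" for t
    unfolding f1_def f_def by (rule parabolic_cylinder_derivative_raise[OF \<zeta>'])
  have g': "(g has_field_derivative g1 t) (at t)" for t
    using parabolic_cylinder_derivative_raise[OF i\<zeta>', of "- a - 1" t] unfolding g1_def g_def by simp
  \<comment> \<open>The Weber potential, the same for both solutions.\<close>
  define Q where "Q = (\<lambda>t. \<delta> ^ 2 * (\<zeta> t ^ 2 / 4 - a - 1 / 2))"
  have f1': "(f1 has_field_derivative Q t * f t) (at t)" for t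
  proof -
    have "((\<lambda>t. parabolic_cylinder (a + 1) (\<zeta> t)) has_field_derivative
       ((a + 1) * f t - \<zeta> t / 2 * parabolic_cylinder (a + 1) (\<zeta> t)) * \<delta>) (at t)"
      using parabolic_cylinder_derivative_lower[OF \<zeta>', of "a + 1" t] by (simp add: f_def)
    from DERIV_cmult_right[OF DERIV_diff[OF DERIV_mult'[OF DERIV_cdivide[OF \<zeta>', of 2] f'] this], of \<delta>]
    show ?thesis
      unfolding f1_def by (rule DERIV_cong) (simp add: Q_def f1_def field_simps power2_eq_square)
  qed
  have g1': "(g1 has_field_derivative Q t * g t) (at t)" for t
  proof -
    have "((\<lambda>t. parabolic_cylinder (- a) (\<i> * \<zeta> t)) has_field_derivative
       (- a * g t - \<i> * \<zeta> t / 2 * parabolic_cylinder (- a) (\<i> * \<zeta> t)) * (\<i> * \<delta>)) (at t)"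
      using parabolic_cylinder_derivative_lower[OF i\<zeta>', of "- a" t] by (simp add: g_def)
    from DERIV_cmult_right[OF DERIV_diff[OF DERIV_mult'[OF DERIV_cdivide[OF i\<zeta>', of 2] g'] this], of "\<i> * \<delta>"]
    show ?thesis
      unfolding g1_def by (rule DERIV_cong) (simp add: Q_def g1_def field_simps power2_eq_square)
  qed

  \<comment> \<open>The constant in the numerator is, up to the factor \<open>- \<delta>\<close>, the Wronskian at \<open>\<zeta> 0\<close>.\<close>
  have N: "N = - \<delta> * (- \<i> * exp (- \<i> * (of_real pi * a / 2)))"
  proof -
    have "w - y = \<delta> * \<zeta> 0" using \<delta>\<zeta>[of 0] by simp
    then show ?thesis
      unfolding parabolic_cylinder_wronskian[of a "\<zeta> 0", symmetric] N_def pqrs assms(4) f_def g_def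
      by (simp add: algebra_simps)
  qed
  then have N0: "N \<noteq> 0" using d by simp

  \<comment> \<open>The denominator; removing the Gaussian factor turns Weber's equation into the one of the generating function.\<close>
  define h where "h = (\<lambda>t. A * f t + B * g t)"
  define h1 where "h1 = (\<lambda>t. A * f1 t + B * g1 t)"
  define K where "K = (\<lambda>t. h t * exp (- \<phi> t) / N)"
  define K1 where "K1 = (\<lambda>t. (h1 t - \<delta> * \<zeta> t / 2 * h t) * exp (- \<phi> t) / N)"
  have h': "(h has_field_derivative h1 t) (at t)" for t
    unfolding h_def h1_def by (intro DERIV_add DERIV_cmult f' g')
  have h1': "(h1 has_field_derivative Q t * h t) (at t)" for t
    unfolding h1_def by (rule DERIV_cong[OF DERIV_add[OF DERIV_cmult[OF f1'] DERIV_cmult[OF g1']]])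
      (simp add: h_def algebra_simps)
  have e': "((\<lambda>t. exp (- \<phi> t)) has_field_derivative exp (- \<phi> t) * - (\<delta> * \<zeta> t / 2)) (at t)" for t
    by (rule DERIV_fun_exp[OF DERIV_minus[OF \<phi>']])
  have K': "(K has_field_derivative K1 t) (at t)" for t
    unfolding K_def
    by (rule DERIV_cong[OF DERIV_cdivide[OF DERIV_mult'[OF h' e']]])
      (simp add: K1_def algebra_simps)
  have K1': "(K1 has_field_derivative
      - ((w - y + (x * v - z * u) * t) * K1 t) - (x * v - y * w) * K t) (at t)" for t
  proof -
    have lin: "((\<lambda>t. \<delta> * \<zeta> t / 2) has_field_derivative \<delta> * \<delta> / 2) (at t)"
      by (intro DERIV_cdivide DERIV_cmult \<zeta>')
    have c: "w - y + (x * v - z * u) * t = \<delta> * \<zeta> t"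
      unfolding \<delta>\<zeta> D by simp
    have "(K1 has_field_derivative ((h1 t - \<delta> * \<zeta> t / 2 * h t) * (exp (- \<phi> t) * - (\<delta> * \<zeta> t / 2)) +
        (Q t * h t - (\<delta> * \<zeta> t / 2 * h1 t + \<delta> * \<delta> / 2 * h t)) * exp (- \<phi> t)) / N) (at t)"
      unfolding K1_def
      by (rule DERIV_cdivide[OF DERIV_mult'[OF DERIV_diff[OF h1' DERIV_mult'[OF lin h']] e']])
    then show ?thesis
    proof (rule DERIV_cong)
      show "((h1 t - \<delta> * \<zeta> t / 2 * h t) * (exp (- \<phi> t) * - (\<delta> * \<zeta> t / 2)) +
          (Q t * h t - (\<delta> * \<zeta> t / 2 * h1 t + \<delta> * \<delta> / 2 * h t)) * exp (- \<phi> t)) / N =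
          - ((w - y + (x * v - z * u) * t) * K1 t) - (x * v - y * w) * K t"
        unfolding c xD K_def K1_def Q_def using N0
        by (simp add: field_simps power2_eq_square)
    qed
  qed
  have K0: "K 0 = 1"
  proof -
    have "A * f 0 + B * g 0 = N"
      unfolding A_def B_def N_def pqrs(1,2)[symmetric] by (simp add: algebra_simps)
    then show ?thesis using N0 by (simp add: K_def h_def \<phi>_def)
  qed
  have K10: "K1 0 = - w"
  proof -
    have c: "\<delta> * \<zeta> 0 = w - y" using \<delta>\<zeta>[of 0] by simp
    have "f1 0 = \<delta> * \<zeta> 0 / 2 * p - \<delta> * r"
      unfolding f1_def pqrs(3) pqrs(1)[symmetric] by (simp add: algebra_simps)
    then have f10: "f1 0 = (w - y) / 2 * p - \<delta> * r" unfolding c .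
    have "g1 0 = - (\<delta> * \<zeta> 0) / 2 * q - \<delta>' * s"
      unfolding g1_def pqrs(4) pqrs(2)[symmetric] assms(4) by (simp add: algebra_simps)
    then have g10: "g1 0 = - (w - y) / 2 * q - \<delta>' * s" unfolding c .
    have "h1 0 - \<delta> * \<zeta> 0 / 2 * h 0 = - w * N"
      unfolding h1_def h_def f10 g10 c A_def B_def N_def pqrs(1,2)[symmetric]
      by (simp add: field_simps)
    then show ?thesis using N0 by (simp add: K1_def \<phi>_def)
  qed

  have "(\<lambda>t. z / K t) has_fps_expansion Abs_fps (\<lambda>n. perm_poly n x y z w u v / fact n)"
    by (rule perm_poly_egf_eq_reciprocal[OF K' K1' K0 K10])
  \<comment> \<open>At a zero of \<open>h\<close> both sides are \<open>0\<close> by the convention for division.\<close>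
  also have "(\<lambda>t. z / K t) = (\<lambda>t. z * N * exp (\<phi> t) / h t)"
    using N0 by (auto simp: fun_eq_iff K_def exp_minus field_simps)
  finally show ?thesis
    unfolding N_def h_def A_def B_def f_def g_def \<phi>_def par arg by (simp add: \<zeta>_def)
qed

end
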